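(* Let $K$ be an infinite field, let $m\ge 3$, $t\ge 1$ and $n$ be integers such that $(t+1)(m-1)+1\le n$. Let $X=(x_{ij})$ be the generic $m\times n$ matrix of variables and $S=K[X]$ with the $\mathbb{Z}^n$-grading $\deg x_{ij}=e_j$. Let $H=([n],E)$ be the $m$-uniform hypergraph whose edges are $$[\ell(m-1)+2-m]_m\quad\text{for }\ell=1,\dots,t$$ (that is, $[1]_m,[m]_m,[2m-1]_m,\dots,[t(m-1)+2-m]_m$) and $$\big([(t+1)(m-1)+2-m]_m\setminus\{(t+1)(m-1)+1\}\big)\cup\{1\}.$$ Then $I_H(m)$ is not Cartwright-Sturmfels.
   Context: Notation: $[n]=\{1,\dots,n\}$, $e_j$ is the $j$-th standard basis vector of $\mathbb{Z}^n$, and $[j]_m=\{j,j+1,\dots,j+m-1\}$ for $0<j\le n-m+1$. An $m$-uniform hypergraph $H=([n],E)$ consists of the vertex set $[n]$ and a set $E$ of $m$-element subsets of $[n]$. $I_H(m)$ is the ideal of $K[X]$ generated by the $m$-minors of $X$ whose set of columns is an element of $E$. The group $\mathrm{GL}_m(K)^n$ acts on $S=K[X]$ by $\mathbb{Z}^n$-graded automorphisms, the $j$-th factor acting linearly on the span of $x_{1j},\dots,x_{mj}$. Borel-fixed ideals are those fixed by the product of the subgroups of upper triangular matrices; a radical monomial ideal $J$ is Borel-fixed if and only if for all monomials $x_{ij}w\in J$ one has $x_{kj}w\in J$ for all $k<i$. The $\mathbb{Z}^n$-graded Hilbert series of a finitely generated $\mathbb{Z}^n$-graded module $M=\bigoplus_{a\in\mathbb{N}^n}M_a$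 is $\sum_a(\dim_K M_a)Z^a\in\mathbb{Q}[[Z_1,\dots,Z_n]]$. A $\mathbb{Z}^n$-graded ideal $I$ of $S$ is Cartwright-Sturmfels (CS) if there exists a radical Borel-fixed monomial ideal of $S$ with the same $\mathbb{Z}^n$-graded Hilbert series as $I$. *)

theory Defs
  imports
    "HOL-Library.Poly_Mapping"
    "HOL-Algebra.Ideal"
    "Jordan_Normal_Form.Determinant"
begin

section \<open>The polynomial ring of the generic matrix\<close>

text \<open>
  Polynomials in the variables \<open>x\<^sub>i\<^sub>j\<close> are finitely supported functions from exponent vectors
  to \<open>'k\<close>, with the arithmetic of \<^theory>\<open>HOL-Library.Poly_Mapping\<close>. The type allows all
  indices \<open>(i, j) :: nat \<times> nat\<close>; the ring \<open>S = K[X]\<close> of the generic \<open>m \<times> n\<close> matrix is the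
  subring of the polynomials in the variables with \<open>1 \<le> i \<le> m\<close> and \<open>1 \<le> j \<le> n\<close>.
\<close>

type_synonym monom = "nat \<times> nat \<Rightarrow>\<^sub>0 nat"
type_synonym 'k mpoly = "monom \<Rightarrow>\<^sub>0 'k"

definition const :: "'k::field \<Rightarrow> 'k mpoly" where
  "const c = Poly_Mapping.single 0 c"

definition monom_poly :: "monom \<Rightarrow> 'k::field mpoly" where
  "monom_poly u = Poly_Mapping.single u 1"

definition var :: "nat \<Rightarrow> nat \<Rightarrow> 'k::field mpoly" where
  "var i j = monom_poly (Poly_Mapping.single (i, j) 1)"

definition scale :: "'k::field \<Rightarrow> 'k mpoly \<Rightarrow> 'k mpoly" where
  "scale c p = const c * p"

definition monoms :: "nat \<Rightarrow> nat \<Rightarrow> monom set" where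
  "monoms m n = {u. Poly_Mapping.keys u \<subseteq> {1..m} \<times> {1..n}}"

definition polys :: "nat \<Rightarrow> nat \<Rightarrow> 'k::field mpoly set" where
  "polys m n = {p. Poly_Mapping.keys p \<subseteq> monoms m n}"

definition poly_ring :: "nat \<Rightarrow> nat \<Rightarrow> 'k::field mpoly ring" where
  "poly_ring m n =
     \<lparr>carrier = polys m n, monoid.mult = (*), one = 1, ring.zero = 0, add = (+)\<rparr>"

lemma keys_add_monom: "Poly_Mapping.keys (u + v :: monom) = Poly_Mapping.keys u \<union> Poly_Mapping.keys v"
  by (auto simp: in_keys_iff lookup_add)

lemma polys_closed:
  fixes p q :: "'k::field mpoly"
  assumes "p \<in> polys m n" "q \<in> polys m n"
  shows "p + q \<in> polys m n" "p * q \<in> polys m n" "- p \<in> polys m n"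
proof -
  show "p + q \<in> polys m n"
    using assms Poly_Mapping.keys_add[of p q] by (auto simp: polys_def)
  show "- p \<in> polys m n"
    using assms by (simp add: polys_def)
  show "p * q \<in> polys m n"
    using assms keys_mult[of p q] by (fastforce simp: polys_def monoms_def keys_add_monom)
qed

lemma polys_0 [simp]: "0 \<in> polys m n" and polys_1 [simp]: "1 \<in> polys m n"
  by (auto simp: polys_def monoms_def)

lemma cring_poly_ring: "cring (poly_ring m n :: 'k::field mpoly ring)"
proof (rule cringI)
  show "abelian_group (poly_ring m n :: 'k mpoly ring)"
  proof (rule abelian_groupI)
    fix p :: "'k mpoly" assume "p \<in> carrier (poly_ring m n)"
    then show "\<exists>q\<in>carrier (poly_ring m n). q \<oplus>\<^bsub>poly_ring m n\<^esub> p = \<zero>\<^bsub>poly_ring m n\<^esub>"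
      by (intro bexI[of _ "- p"]) (auto simp: poly_ring_def polys_closed)
  qed (auto simp: poly_ring_def polys_closed algebra_simps)
  show "Group.comm_monoid (poly_ring m n :: 'k mpoly ring)"
    by (rule comm_monoidI) (auto simp: poly_ring_def polys_closed algebra_simps)
qed (auto simp: poly_ring_def algebra_simps)

lemma vector_space_scale: "vector_space (scale :: 'k::field \<Rightarrow> 'k mpoly \<Rightarrow> 'k mpoly)"
  by unfold_locales
    (auto simp: scale_def const_def algebra_simps single_add mult_single
      simp flip: mult.assoc)


section \<open>Multigrading and Hilbert series\<close>

text \<open>
  All degrees that occur lie in \<open>\<nat>\<^sup>n\<close>; they are represented by finitely supported
  functions on the column indices.
\<close>

definition mdeg :: "monom \<Rightarrow> (nat \<Rightarrow>\<^sub>0 nat)" where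
  "mdeg u = (\<Sum>(i, j)\<in>Poly_Mapping.keys u. Poly_Mapping.single j (Poly_Mapping.lookup u (i, j)))"

definition graded_part :: "nat \<Rightarrow> nat \<Rightarrow> (nat \<Rightarrow>\<^sub>0 nat) \<Rightarrow> 'k::field mpoly set" where
  "graded_part m n a = {p \<in> polys m n. \<forall>u\<in>Poly_Mapping.keys p. mdeg u = a}"

text \<open>
  A formal power series over \<open>\<rat>\<close> is the family of its coefficients, indexed by exponent vectors.
  The coefficients at exponent vectors not supported in \<open>{1..n}\<close> are \<open>0\<close>.
\<close>

definition hilbert_series :: "nat \<Rightarrow> nat \<Rightarrow> 'k::field mpoly set \<Rightarrow> (nat \<Rightarrow>\<^sub>0 nat) \<Rightarrow> rat" where
  "hilbert_series m n I = (\<lambda>a. of_nat (vector_space.dim scale (I \<inter> graded_part m n a)))"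


section \<open>Borel-fixed ideals and Cartwright-Sturmfels ideals\<close>

text \<open>
  The family \<open>g\<close> acts by the substitution \<open>x\<^sub>i\<^sub>j \<mapsto> \<Sum>k. (g j)\<^sub>k\<^sub>i x\<^sub>k\<^sub>j\<close>, i.e. \<open>g j\<close> is the matrix of
  the action with respect to the basis \<open>x\<^sub>1\<^sub>j, \<dots>, x\<^sub>m\<^sub>j\<close>. Matrix entries are indexed from \<open>0\<close>.
\<close>

definition gl_act :: "nat \<Rightarrow> (nat \<Rightarrow> 'k::field mat) \<Rightarrow> 'k mpoly \<Rightarrow> 'k mpoly" where
  "gl_act m g p =
     (\<Sum>u\<in>Poly_Mapping.keys p. const (Poly_Mapping.lookup p u) *
        (\<Prod>(i, j)\<in>Poly_Mapping.keys u. (\<Sum>k = 1..m. const (g j $$ (k - 1, i - 1)) * var k j) ^ Poly_Mapping.lookup u (i, j)))"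

definition borel_group :: "nat \<Rightarrow> nat \<Rightarrow> (nat \<Rightarrow> 'k::field mat) set" where
  "borel_group m n =
     {g. \<forall>j\<in>{1..n}. g j \<in> carrier_mat m m \<and> invertible_mat (g j) \<and> upper_triangular (g j)}"

definition borel_fixed :: "nat \<Rightarrow> nat \<Rightarrow> 'k::field mpoly set \<Rightarrow> bool" where
  "borel_fixed m n J \<longleftrightarrow> (\<forall>g\<in>borel_group m n. gl_act m g ` J = J)"

definition monomial_ideal :: "nat \<Rightarrow> nat \<Rightarrow> 'k::field mpoly set \<Rightarrow> bool" where
  "monomial_ideal m n J \<longleftrightarrow>
     (\<exists>M \<subseteq> monoms m n. J = genideal (poly_ring m n) (monom_poly ` M))"

definition radical_ideal :: "nat \<Rightarrow> nat \<Rightarrow> 'k::field mpoly set \<Rightarrow> bool" where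
  "radical_ideal m n J \<longleftrightarrow>
     ideal J (poly_ring m n) \<and> (\<forall>p\<in>polys m n. \<forall>k. p ^ k \<in> J \<longrightarrow> p \<in> J)"

text \<open>
  The notion is meant for multigraded ideals \<open>I\<close> of \<open>poly_ring m n\<close>. Homogeneity is not made
  a conjunct, so that the negation asserts the absence of a suitable \<open>J\<close>.
\<close>

definition cartwright_sturmfels :: "nat \<Rightarrow> nat \<Rightarrow> 'k::field mpoly set \<Rightarrow> bool" where
  "cartwright_sturmfels m n I \<longleftrightarrow>
     (\<exists>J :: 'k mpoly set. monomial_ideal m n J \<and> radical_ideal m n J \<and> borel_fixed m n J \<and>
        hilbert_series m n J = hilbert_series m n I)"


section \<open>Determinantal ideals of hypergraphs\<close>

text \<open>The \<open>m\<close>-minor of \<open>X\<close> with column set \<open>e\<close> (where \<open>card e = m\<close>), columns in increasing order.\<close>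

definition minor :: "nat \<Rightarrow> nat set \<Rightarrow> 'k::field mpoly" where
  "minor m e = det (mat m m (\<lambda>(i, j). var (i + 1) (sorted_list_of_set e ! j)))"

text \<open>\<open>E\<close> is the edge set of an \<open>m\<close>-uniform hypergraph on \<open>{1..n}\<close>.\<close>

definition hypergraph_ideal :: "nat \<Rightarrow> nat \<Rightarrow> nat set set \<Rightarrow> 'k::field mpoly set" where
  "hypergraph_ideal m n E = genideal (poly_ring m n) (minor m ` E)"

text \<open>The set \<open>[j]\<^sub>m\<close> of \<open>m\<close> consecutive integers starting with \<open>j\<close>.\<close>

definition block :: "nat \<Rightarrow> nat \<Rightarrow> nat set" where
  "block j m = {j..j + m - 1}"

end

theory Submission
  imports Defs "HOL-Computational_Algebra.Formal_Power_Series"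
begin

text \<open>
  For a radical Borel-fixed monomial ideal \<open>J\<close>, whether a monomial lies in \<open>J\<close> depends only on
  the first row occurring in each column. The Hilbert series of \<open>S / J\<close> is therefore a sum,
  with coefficients \<open>0\<close> or \<open>1\<close>, of products over the columns of the linearly independent
  series \<open>1\<close> and \<open>Z\<^sub>j / (1 - Z\<^sub>j)\<^sup>k\<close> for \<open>1 \<le> k \<le> m\<close>. A product of linear functionals on the
  columns extracts one of these coefficients.

  The edges form a cycle in which consecutive edges share one column, the joints. As
  \<open>m \<ge> 3\<close>, there is a weight for which the leading monomials of the minors are pairwise coprime:
  the two edges at a joint can use different rows. Hence the minors have the same
  Hilbert function as their leading monomials. The coefficient that belongs to row \<open>2\<close> at the
  joints and to row \<open>1\<close> at the other columns is then \<open>2\<close>: the relevant monomials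
  are divisible either by the first or by the second of the two variables at every joint.
\<close>


section \<open>Ideals of the polynomial ring and monomials\<close>

text \<open>Two points decide. The weight: if every edge matched rows 1 and \<open>m\<close> to its
  two joints, the excess of row \<open>m\<close> over row 1 would have to increase strictly from
  joint to joint all the way around the cycle, which is impossible. The last edge therefore takes
  row 2 in column 1, and its inner columns move up to rows \<open>3..m\<close>. The count 2: the
  functional of column \<open>j\<close> kills every first-row class except row
  \<open>d j + 1\<close>, so on the Borel side at most one vector of classes survives. For the
  minors a column is classified by the variables of leading monomials that divide it. An inner
  column has value 1 if its variable divides and 0 otherwise; a joint has value 0, 1 or -1 if none,
  exactly one or both of its variables divide. When no leading monomial divides but all inner
  variables do, the row 1 variable at one joint forbids the other variable at the next joint, where
  row 1 is then forced as well. So all joints choose alike, and the value -1 never occurs.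
  Truncating column degrees at \<open>m\<close> turns the functionals into finite weighted counts of
  monomials.\<close>

abbreviation lookup where "lookup \<equiv> Poly_Mapping.lookup"
abbreviation keys where "keys \<equiv> Poly_Mapping.keys"
abbreviation single where "single \<equiv> Poly_Mapping.single"

interpretation mpv: vector_space "scale :: 'k::field \<Rightarrow> 'k mpoly \<Rightarrow> 'k mpoly"
  by (rule vector_space_scale)

lemma scale_monom_poly: "scale c (monom_poly u) = single u c"
  by (simp add: scale_def const_def monom_poly_def mult_single)

lemma lookup_scale: "lookup (scale c p) u = c * lookup p u"
  unfolding scale_def const_def mult_map_scale_conv_mult[symmetric]
  by (simp add: Poly_Mapping.map.rep_eq when_def)

lemma monom_poly_mult: "monom_poly u * monom_poly v = monom_poly (u + v)"
  by (simp add: monom_poly_def mult_single)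

lemma monom_poly_0: "monom_poly 0 = 1"
  by (simp add: monom_poly_def)

lemma monom_poly_prod:
  "(\<Prod>x\<in>A. monom_poly (f x)) = monom_poly (\<Sum>x\<in>A. f x)"
  by (induction A rule: infinite_finite_induct) (auto simp: monom_poly_0 monom_poly_mult)

lemma keys_monom_poly [simp]: "keys (monom_poly u :: 'k::field mpoly) = {u}"
  by (simp add: monom_poly_def)

lemma monom_poly_eq_iff [simp]: "(monom_poly u :: 'k::field mpoly) = monom_poly v \<longleftrightarrow> u = v"
  by (metis keys_monom_poly singleton_inject)

lemma mpoly_eq_sum: "p = (\<Sum>u\<in>keys p. scale (lookup p u) (monom_poly u))"
proof (rule poly_mapping_eqI)
  fix v
  have "lookup (\<Sum>u\<in>keys p. scale (lookup p u) (monom_poly u)) v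
      = (\<Sum>u\<in>keys p. if u = v then lookup p u else 0)"
    by (simp add: lookup_sum scale_monom_poly lookup_single when_def)
  also have "\<dots> = lookup p v"
    by (auto simp: in_keys_iff)
  finally show "lookup p v = lookup (\<Sum>u\<in>keys p. scale (lookup p u) (monom_poly u)) v" ..
qed

lemma monom_le_split:
  fixes u v :: "'a \<Rightarrow>\<^sub>0 nat"
  assumes "\<And>x. lookup u x \<le> lookup v x"
  shows "v = u + (v - u)"
  by (rule poly_mapping_eqI) (simp add: lookup_add lookup_minus assms)

lemma monoms_add [simp]: "u + v \<in> monoms m n \<longleftrightarrow> u \<in> monoms m n \<and> v \<in> monoms m n"
  by (simp add: monoms_def keys_add_monom)

lemma monoms_0 [simp]: "0 \<in> monoms m n"
  by (simp add: monoms_def)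

lemma monom_poly_polys: "monom_poly u \<in> polys m n \<longleftrightarrow> u \<in> monoms m n"
  by (simp add: polys_def)

lemma const_polys: "const c \<in> polys m n"
  by (simp add: polys_def const_def monoms_def)

lemma monoms_subsetI:
  assumes "v \<in> monoms m n" "keys u \<subseteq> keys v" shows "u \<in> monoms m n"
  using assms by (auto simp: monoms_def)

lemma ideal_poly_ring_iff:
  fixes I :: "'k::field mpoly set"
  shows "ideal I (poly_ring m n) \<longleftrightarrow>
    I \<subseteq> polys m n \<and> 0 \<in> I \<and> (\<forall>p\<in>I. \<forall>q\<in>I. p + q \<in> I) \<and> (\<forall>p\<in>I. \<forall>q\<in>polys m n. q * p \<in> I)"
  (is "_ \<longleftrightarrow> ?R")
proof
  assume I: "ideal I (poly_ring m n)"
  then interpret ideal I "poly_ring m n :: 'k mpoly ring" .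
  show ?R
    using a_subset additive_subgroup.zero_closed[OF is_additive_subgroup]
      additive_subgroup.a_closed[OF is_additive_subgroup] I_l_closed
    by (auto simp: poly_ring_def)
next
  assume R: ?R
  interpret cring "poly_ring m n :: 'k mpoly ring" by (rule cring_poly_ring)
  have neg: "- p \<in> I" if "p \<in> I" for p
  proof -
    have "(- 1) * p \<in> I"
      using R that by (blast intro: polys_closed polys_1)
    then show ?thesis by simp
  qed
  show "ideal I (poly_ring m n)"
  proof (rule idealI)
    show "ring (poly_ring m n :: 'k mpoly ring)" by (rule ring_axioms)
    have inv: "\<ominus>\<^bsub>poly_ring m n\<^esub> p = - p" if "p \<in> polys m n" for p :: "'k mpoly"
      by (rule minus_equality) (use that in \<open>auto simp: poly_ring_def polys_closed\<close>)
    show "subgroup I (add_monoid (poly_ring m n))"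
    proof
      fix p assume "p \<in> I"
      then show "m_inv (add_monoid (poly_ring m n)) p \<in> I"
        using neg inv[of p] R by (auto simp: a_inv_def)
    qed (use R in \<open>auto simp: poly_ring_def\<close>)
  qed (use R in \<open>auto simp: poly_ring_def mult.commute\<close>)
qed

lemma ideal_sum:
  assumes "ideal I (poly_ring m n)" "\<And>x. x \<in> A \<Longrightarrow> f x \<in> I"
  shows "(\<Sum>x\<in>A. f x) \<in> I"
  using assms(2)
  by (induction A rule: infinite_finite_induct) (use assms(1) in \<open>auto simp: ideal_poly_ring_iff\<close>)

lemma genideal_ideal_poly_ring:
  "S \<subseteq> polys m n \<Longrightarrow> ideal (genideal (poly_ring m n) S) (poly_ring m n)"
  by (rule ring.genideal_ideal) (auto simp: poly_ring_def cring.axioms(1)[OF cring_poly_ring, unfolded poly_ring_def])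

lemma genideal_superset_poly_ring:
  "S \<subseteq> polys m n \<Longrightarrow> S \<subseteq> genideal (poly_ring m n) S"
  by (rule ring.genideal_self) (auto simp: poly_ring_def cring.axioms(1)[OF cring_poly_ring, unfolded poly_ring_def])

lemma genideal_least_poly_ring:
  "ideal I (poly_ring m n) \<Longrightarrow> S \<subseteq> I \<Longrightarrow> genideal (poly_ring m n) S \<subseteq> I"
  by (rule ring.genideal_minimal) (auto simp: cring.axioms(1)[OF cring_poly_ring])

text \<open>With \<open>N\<close> the set of all multiples of the generators, every question about
  \<open>J\<close> becomes one about a set of monomials closed under multiplication.\<close>

lemma monomial_idealE:
  fixes J :: "'k::field mpoly set"
  assumes "monomial_ideal m n J"
  obtains N where "N \<subseteq> monoms m n" "J = {p. keys p \<subseteq> N}"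
    "\<And>u v. u \<in> N \<Longrightarrow> v \<in> monoms m n \<Longrightarrow> u + v \<in> N"
proof -
  from assms obtain M where M: "M \<subseteq> monoms m n" "J = genideal (poly_ring m n) (monom_poly ` M)"
    by (auto simp: monomial_ideal_def)
  define N where "N = {u + v |u v. u \<in> M \<and> v \<in> monoms m n}"
  have N: "N \<subseteq> monoms m n" using M by (auto simp: N_def)
  have up: "u + v \<in> N" if "u \<in> N" "v \<in> monoms m n" for u v
    using that by (auto simp: N_def) (metis add.assoc monoms_add)
  have gens: "monom_poly ` M \<subseteq> (polys m n :: 'k mpoly set)"
    using M by (auto simp: monom_poly_polys)
  have "J \<subseteq> {p. keys p \<subseteq> N}"
    unfolding M(2)
  proof (rule genideal_least_poly_ring)
    show "ideal {p :: 'k mpoly. keys p \<subseteq> N} (poly_ring m n)"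
      unfolding ideal_poly_ring_iff
    proof (intro conjI ballI)
      fix p q :: "'k mpoly" assume "p \<in> {p. keys p \<subseteq> N}" "q \<in> polys m n"
      then show "q * p \<in> {p. keys p \<subseteq> N}"
        using keys_mult[of q p] up by (fastforce simp: polys_def add.commute)
    qed (use N Poly_Mapping.keys_add in \<open>fastforce simp: polys_def\<close>)+
    show "monom_poly ` M \<subseteq> {p :: 'k mpoly. keys p \<subseteq> N}"
      by (auto simp: N_def) (metis add.right_neutral monoms_0)
  qed
  moreover have "{p. keys p \<subseteq> N} \<subseteq> J"
  proof
    fix p :: "'k mpoly" assume p: "p \<in> {p. keys p \<subseteq> N}"
    have J: "ideal J (poly_ring m n)" unfolding M(2) by (rule genideal_ideal_poly_ring[OF gens])
    have "scale c (monom_poly u) \<in> J" if "u \<in> N" for c u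
    proof -
      from that obtain a b where ab: "u = a + b" "a \<in> M" "b \<in> monoms m n" by (auto simp: N_def)
      have "monom_poly a \<in> J" using genideal_superset_poly_ring[OF gens] ab M(2) by auto
      then have "(const c * monom_poly b) * monom_poly a \<in> J"
        using J ab const_polys[of c m n] monom_poly_polys[of b m n]
        unfolding ideal_poly_ring_iff by (meson polys_closed(2))
      then show ?thesis
        by (simp add: scale_def ab monom_poly_mult mult.assoc add.commute)
    qed
    then show "p \<in> J"
      by (subst mpoly_eq_sum) (use p in \<open>auto intro!: ideal_sum[OF J]\<close>)
  qed
  ultimately show thesis using that N up by blast
qed

lemma span_monom_poly: "mpv.span (monom_poly ` F :: 'k::field mpoly set) = {p. keys p \<subseteq> F}"
proof
  have "mpv.subspace {p :: 'k mpoly. keys p \<subseteq> F}"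
  proof (rule mpv.subspaceI)
    fix p q :: "'k mpoly" and c
    assume pq: "p \<in> {p. keys p \<subseteq> F}" "q \<in> {p. keys p \<subseteq> F}"
    show "p + q \<in> {p. keys p \<subseteq> F}"
      using pq Poly_Mapping.keys_add[of p q] by auto
    show "scale c p \<in> {p. keys p \<subseteq> F}"
      using pq by (auto simp: in_keys_iff lookup_scale)
  qed simp
  then show "mpv.span (monom_poly ` F) \<subseteq> {p :: 'k mpoly. keys p \<subseteq> F}"
    by (intro mpv.span_minimal) auto
  show "{p :: 'k mpoly. keys p \<subseteq> F} \<subseteq> mpv.span (monom_poly ` F)"
  proof
    fix p :: "'k mpoly" assume "p \<in> {p. keys p \<subseteq> F}"
    then show "p \<in> mpv.span (monom_poly ` F)"
      by (subst mpoly_eq_sum, intro mpv.span_sum mpv.span_scale) (auto intro: mpv.span_base)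
  qed
qed


section \<open>Radical Borel-fixed monomial ideals\<close>

text \<open>A weight may have ties, so the leading term must beat every other term strictly. This
  takes the place of a monomial order.\<close>

definition leads :: "(monom \<Rightarrow> nat) \<Rightarrow> 'k::field mpoly \<Rightarrow> monom \<Rightarrow> bool" where
  "leads w p u \<longleftrightarrow> lookup p u \<noteq> 0 \<and> (\<forall>v\<in>keys p. v \<noteq> u \<longrightarrow> w v < w u)"

lemma leads_unique:
  assumes "leads w p u" "leads w p v" shows "u = v"
proof (rule ccontr)
  assume "u \<noteq> v"
  moreover have "u \<in> keys p" "v \<in> keys p"
    using assms by (simp_all add: leads_def in_keys_iff)
  ultimately have "w u < w v" "w v < w u"
    using assms by (auto simp: leads_def)
  then show False by simp
qed

lemma leads_monom_poly: "leads w (monom_poly u) u"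
  by (simp add: leads_def monom_poly_def)

text \<open>In a nontrivial relation, pick a monomial \<open>u\<close> of maximal weight among the
  indices with nonzero coefficient. No other member of the relation has \<open>u\<close> as a term,
  so the coefficient of \<open>u\<close> cannot cancel.\<close>

lemma leads_independent:
  fixes \<phi> :: "monom \<Rightarrow> 'k::field mpoly"
  assumes "\<And>u. u \<in> F \<Longrightarrow> leads w (\<phi> u) u"
  shows "inj_on \<phi> F" "mpv.independent (\<phi> ` F)"
proof -
  show inj: "inj_on \<phi> F"
    using assms leads_unique by (metis inj_onI)
  show "mpv.independent (\<phi> ` F)"
    unfolding mpv.independent_explicit_finite_subsets
  proof (intro allI impI, rule ccontr)
    fix S c assume S: "S \<subseteq> \<phi> ` F" "finite S" "(\<Sum>p\<in>S. scale (c p) p) = 0"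
      and nz: "\<not> (\<forall>p\<in>S. c p = 0)"
    obtain T where T: "T \<subseteq> F" "S = \<phi> ` T" using S(1) by (meson subset_imageE)
    have injT: "inj_on \<phi> T" using inj T(1) inj_on_subset by blast
    have finT: "finite T" using S(2) T(2) injT finite_imageD by blast
    define T' where "T' = {u\<in>T. c (\<phi> u) \<noteq> 0}"
    have "finite T'" "T' \<noteq> {}" using finT nz T by (auto simp: T'_def)
    then have "Max (w ` T') \<in> w ` T'" by auto
    then obtain u where u: "u \<in> T'" "w u = Max (w ` T')" by auto
    have max: "w v \<le> w u" if "v \<in> T'" for v
      using that u \<open>finite T'\<close> by auto
    have zero: "c (\<phi> v) * lookup (\<phi> v) u = 0" if "v \<in> T" "v \<noteq> u" for v
    proof (cases "v \<in> T'")
      case True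
      then show ?thesis
        using assms[of v] max[of v] that T by (force simp: leads_def in_keys_iff)
    qed (use that in \<open>simp add: T'_def\<close>)
    have "0 = lookup (\<Sum>v\<in>T. scale (c (\<phi> v)) (\<phi> v)) u"
      using S(3) by (simp add: T(2) sum.reindex[OF injT])
    also have "\<dots> = (\<Sum>v\<in>T. c (\<phi> v) * lookup (\<phi> v) u)"
      by (simp add: lookup_sum lookup_scale)
    also have "\<dots> = (\<Sum>v\<in>{u}. c (\<phi> v) * lookup (\<phi> v) u)"
      by (rule sum.mono_neutral_right) (use finT u zero in \<open>auto simp: T'_def\<close>)
    finally show False
      using u assms[of u] T(1) by (auto simp: T'_def leads_def)
  qed
qed

lemma dim_monomial_span:
  "mpv.dim {p :: 'k::field mpoly. keys p \<subseteq> F} = card F"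
proof (rule mpv.dim_unique)
  show "{p :: 'k mpoly. keys p \<subseteq> F} \<subseteq> mpv.span (monom_poly ` F)"
    by (simp add: span_monom_poly)
  \<comment> \<open>A monomial has a single term, so strictness is vacuous and any weight will
    do.\<close>
  show "mpv.independent (monom_poly ` F :: 'k mpoly set)"
    by (rule leads_independent(2)[where w="\<lambda>_. 0"]) (auto simp: leads_def monom_poly_def)
  show "card (monom_poly ` F :: 'k mpoly set) = card F"
    by (rule card_image) (auto intro: inj_onI)
qed auto

section \<open>Membership of monomials in radical Borel-fixed ideals\<close>

lemma monom_poly_power:
  obtains v where "monom_poly u ^ k = (monom_poly v :: 'k::field mpoly)" "\<And>x. lookup v x = k * lookup u x"
proof (induction k arbitrary: thesis)
  case 0
  show ?case by (rule 0[of 0]) (auto simp: monom_poly_0)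
next
  case (Suc k)
  then obtain v where "monom_poly u ^ k = (monom_poly v :: 'k mpoly)" "\<And>x. lookup v x = k * lookup u x"
    by blast
  then show ?case
    by (intro Suc.prems[of "u + v"]) (auto simp: monom_poly_mult lookup_add)
qed

lemma var_power: "var i j ^ d = monom_poly (single (i, j) d)"
proof (induction d)
  case (Suc d)
  have "monom_poly (single (i, j) 1) * monom_poly (single (i, j) d) = (monom_poly (single (i, j) (Suc d)) :: 'a mpoly)"
    unfolding monom_poly_mult single_add[symmetric] by simp
  then show ?case unfolding power_Suc Suc by (simp only: var_def)
qed (simp add: monom_poly_0)

text \<open>If the support of \<open>v\<close> contains that of \<open>u\<close>, some power of
  \<open>v\<close> is divisible by \<open>u\<close>; the total degree of \<open>u\<close> suffices
  as exponent. Radicality then removes the power.\<close>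

lemma radical_monomial_support:
  fixes J :: "'k::field mpoly set"
  assumes rad: "radical_ideal m n J" and J: "J = {p. keys p \<subseteq> N}"
    and up: "\<And>u v. u \<in> N \<Longrightarrow> v \<in> monoms m n \<Longrightarrow> u + v \<in> N"
    and uv: "u \<in> N" "v \<in> monoms m n" "keys u \<subseteq> keys v"
  shows "v \<in> N"
proof -
  define k where "k = (\<Sum>x\<in>keys u. lookup u x)"
  obtain v' where v': "monom_poly v ^ k = (monom_poly v' :: 'k mpoly)" "\<And>x. lookup v' x = k * lookup v x"
    using monom_poly_power by blast
  have le: "lookup u x \<le> lookup v' x" for x
  proof (cases "x \<in> keys u")
    case True
    then have "lookup u x \<le> k" unfolding k_def by (intro member_le_sum) auto
    moreover have "x \<in> keys v" using True uv(3) by blast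
    then have "1 \<le> lookup v x" by (simp add: in_keys_iff Suc_le_eq)
    ultimately show ?thesis
      using mult_le_mono[of "lookup u x" k 1 "lookup v x"] by (simp only: v'(2) mult_1_right)
  qed (simp add: in_keys_iff)
  have "keys v' \<subseteq> keys v" by (auto simp: in_keys_iff v')
  then have "v' - u \<in> monoms m n"
    by (intro monoms_subsetI[OF uv(2)]) (auto simp: in_keys_iff lookup_minus)
  then have "v' \<in> N"
    using up[OF uv(1)] monom_le_split[OF le] by metis
  then have "monom_poly v ^ k \<in> J" by (simp add: J v'(1))
  then have "monom_poly v \<in> J"
    using rad uv(2) by (auto simp: radical_ideal_def monom_poly_polys)
  then show ?thesis by (simp add: J)
qed

text \<open>The extreme term of the binomial expansion has coefficient 1 in every characteristic,
  whereas the intermediate binomial coefficients may vanish.\<close>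

lemma lookup_add_power:
  assumes "x \<noteq> y"
  shows "lookup ((monom_poly (single x 1) + monom_poly (single y 1)) ^ d * monom_poly r :: 'k::field mpoly)
    (single y d + r) = 1"
proof -
  have pow: "monom_poly (single z 1) ^ e = (monom_poly (single z e) :: 'k mpoly)" for z e
    using var_power[of "fst z" "snd z" e] by (simp add: var_def)
  have "(monom_poly (single x 1) + monom_poly (single y 1)) ^ d * monom_poly r
    = (\<Sum>e\<le>d. single (single x e + single y (d - e) + r) (of_nat (d choose e) :: 'k))"
    unfolding binomial_ring sum_distrib_right
    unfolding pow
    by (rule sum.cong[OF refl])
      (simp add: monom_poly_def mult_single add.assoc mult.assoc flip: single_of_nat)
  moreover have "single x e + single y (d - e) + r = single y d + r \<longleftrightarrow> e = 0" for e
  proof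
    assume "single x e + single y (d - e) + r = single y d + r"
    then have "lookup (single x e + single y (d - e)) x = lookup (single y d) x"
      by simp
    then show "e = 0"
      using assms by (simp add: lookup_add lookup_single when_def split: if_splits)
  qed simp
  ultimately show ?thesis
    by (simp add: lookup_sum lookup_single when_def)
qed

lemma transvection_in_borel_group:
  assumes "1 \<le> k" "k < i" "i \<le> m"
  shows "(\<lambda>j'. if j' = j then addrow_mat m 1 (k - 1) (i - 1) else 1\<^sub>m m) \<in> (borel_group m n :: (nat \<Rightarrow> 'k::field mat) set)"
proof -
  have "invertible_mat (1\<^sub>m m :: 'k mat)"
    by (auto simp: invertible_mat_def inverts_mat_def intro!: exI[of _ "1\<^sub>m m"])
  moreover have "invertible_mat (addrow_mat m 1 (k - 1) (i - 1) :: 'k mat)"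
    using addrow_mat_inv[of "k - 1" m "i - 1" "1 :: 'k"] addrow_mat_inv[of "k - 1" m "i - 1" "- 1 :: 'k"] assms
    by (auto simp: invertible_mat_def inverts_mat_def intro!: exI[of _ "addrow_mat m (- 1) (k - 1) (i - 1)"])
  ultimately show ?thesis
    using assms by (auto simp: borel_group_def upper_triangular_def)
qed

lemma gl_act_transvection:
  assumes k: "1 \<le> k" "k < i" "i \<le> m" and u: "u \<in> monoms m n"
  shows "gl_act m (\<lambda>j'. if j' = j then addrow_mat m 1 (k - 1) (i - 1) else 1\<^sub>m m) (monom_poly u :: 'k::field mpoly)
    = (var i j + var k j) ^ lookup u (i, j) *
      monom_poly (\<Sum>x\<in>keys u - {(i, j)}. single x (lookup u x))"
    (is "gl_act m ?g _ = _")
proof -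
  have row: "(\<Sum>l = 1..m. const (?g j' $$ (l - 1, i' - 1)) * var l j') =
      (if (i', j') = (i, j) then var i j + var k j else var i' j' :: 'k mpoly)"
    if "i' \<in> {1..m}" for i' j'
  proof -
    have "(\<Sum>l = 1..m. const (?g j' $$ (l - 1, i' - 1)) * var l j') =
      (\<Sum>l = 1..m. (if l = i' then var i' j' else 0) +
         (if l = k then if (i', j') = (i, j) then var k j else 0 else 0) :: 'k mpoly)"
    proof (rule sum.cong[OF refl])
      fix l assume l: "l \<in> {1..m}"
      have *: "l - 1 < m" "i' - 1 < m" "l - 1 = i' - 1 \<longleftrightarrow> l = i'" "k - 1 = l - 1 \<longleftrightarrow> l = k"
        "i - 1 = i' - 1 \<longleftrightarrow> i' = i"
        using l that k by auto
      have "?g j' $$ (l - 1, i' - 1) = (if l = i' then 1 else 0) + (if l = k \<and> (i', j') = (i, j) then 1 else 0)"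
        using k by (cases "j' = j") (simp_all add: * del: One_nat_def)
      then show "const (?g j' $$ (l - 1, i' - 1)) * var l j' = (if l = i' then var i' j' else 0) +
         (if l = k then if (i', j') = (i, j) then var k j else 0 else (0 :: 'k mpoly))"
        using k by (auto simp: const_def)
    qed
    also have "\<dots> = (if (i', j') = (i, j) then var i j + var k j else var i' j')"
      using that k by (simp add: sum.distrib)
    finally show ?thesis .
  qed
  have rng: "fst x \<in> {1..m}" if "x \<in> keys u" for x
    using u that by (auto simp: monoms_def)
  have "gl_act m ?g (monom_poly u :: 'k mpoly)
    = (\<Prod>(i', j')\<in>keys u. (\<Sum>l = 1..m. const (?g j' $$ (l - 1, i' - 1)) * var l j') ^ lookup u (i', j'))"
    unfolding gl_act_def keys_monom_poly by (simp add: monom_poly_def const_def)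
  also have "\<dots> = (\<Prod>x\<in>keys u. (if x = (i, j) then var i j + var k j else var (fst x) (snd x)) ^ lookup u x)"
  proof (rule prod.cong[OF refl])
    fix x assume "x \<in> keys u"
    with rng row[of "fst x" "snd x"] show
      "(case x of (i', j') \<Rightarrow> (\<Sum>l = 1..m. const (?g j' $$ (l - 1, i' - 1)) * var l j') ^ lookup u (i', j'))
       = (if x = (i, j) then var i j + var k j else var (fst x) (snd x)) ^ lookup u x"
      by (cases x) (auto simp only: fst_conv snd_conv prod.case)
  qed
  \<comment> \<open>The factor of \<open>(i, j)\<close> is split off even if its exponent is 0,
    which saves a case distinction.\<close>
  also have "\<dots> = (\<Prod>x\<in>insert (i, j) (keys u). (if x = (i, j) then var i j + var k j else var (fst x) (snd x)) ^ lookup u x)"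
    by (rule prod.mono_neutral_left) (auto simp: in_keys_iff)
  also have "\<dots> = (var i j + var k j) ^ lookup u (i, j) *
      (\<Prod>x\<in>keys u - {(i, j)}. var (fst x) (snd x) ^ lookup u x)"
    by (simp add: prod.insert_remove)
  also have "(\<Prod>x\<in>keys u - {(i, j)}. var (fst x) (snd x) ^ lookup u x) =
      monom_poly (\<Sum>x\<in>keys u - {(i, j)}. single x (lookup u x))"
    by (simp add: var_power monom_poly_prod)
  finally show ?thesis .
qed

text \<open>A monomial ideal contains every term of its elements, and the transvection
  \<open>x_ij \<mapsto> x_ij + x_kj\<close> produces the term in which the whole power of
  \<open>x_ij\<close> has become a power of \<open>x_kj\<close>. Only supports matter later, so
  moving the whole power at once is harmless.\<close>

lemma borel_exchange:
  fixes J :: "'k::field mpoly set"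
  assumes bor: "borel_fixed m n J" and J: "J = {p. keys p \<subseteq> N}" and N: "N \<subseteq> monoms m n"
    and u: "u \<in> N" "(i, j) \<in> keys u" and k: "1 \<le> k" "k < i"
  obtains u' where "u' \<in> N" "keys u' = insert (k, j) (keys u - {(i, j)})"
proof -
  define g :: "nat \<Rightarrow> 'k mat" where "g = (\<lambda>j'. if j' = j then addrow_mat m 1 (k - 1) (i - 1) else 1\<^sub>m m)"
  define r where "r = (\<Sum>x\<in>keys u - {(i, j)}. single x (lookup u x))"
  have i: "i \<le> m" using u N by (fastforce simp: monoms_def)
  have "g \<in> borel_group m n"
    unfolding g_def by (rule transvection_in_borel_group[OF k i])
  then have "gl_act m g ` J = J"
    using bor by (simp add: borel_fixed_def)
  moreover have "monom_poly u \<in> J"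
    using u(1) by (simp add: J)
  ultimately have "gl_act m g (monom_poly u) \<in> J"
    by blast
  then have "keys (gl_act m g (monom_poly u)) \<subseteq> N" by (simp add: J)
  moreover have "lookup (gl_act m g (monom_poly u)) (single (k, j) (lookup u (i, j)) + r) = 1"
    using lookup_add_power[of "(i, j)" "(k, j)" "lookup u (i, j)" r] k u(1) N
    unfolding g_def by (subst gl_act_transvection[OF k i]) (auto simp: r_def var_def)
  ultimately have N': "single (k, j) (lookup u (i, j)) + r \<in> N"
    by (auto simp: subset_iff in_keys_iff)
  have "lookup r x = (if x = (i, j) then 0 else lookup u x)" for x
    by (auto simp: r_def lookup_sum lookup_single when_def in_keys_iff)
  then have "keys r = keys u - {(i, j)}"
    by (auto simp: in_keys_iff split: if_splits)
  then have "keys (single (k, j) (lookup u (i, j)) + r) = insert (k, j) (keys u - {(i, j)})"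
    using u(2) by (auto simp: keys_add_monom in_keys_iff)
  with N' that show thesis by blast
qed

text \<open>A variable of \<open>u\<close> missing from \<open>v\<close> can be moved up to a
  variable of \<open>v\<close> in the same column, which lowers the number of missing variables.
  Once none is missing, radicality applies. In particular, membership depends only on the first rows
  of the columns.\<close>

lemma radical_borel_fixed_dominates:
  fixes J :: "'k::field mpoly set"
  assumes rad: "radical_ideal m n J" and bor: "borel_fixed m n J"
    and J: "J = {p. keys p \<subseteq> N}" and N: "N \<subseteq> monoms m n"
    and up: "\<And>u v. u \<in> N \<Longrightarrow> v \<in> monoms m n \<Longrightarrow> u + v \<in> N"
    and u: "u \<in> N" and v: "v \<in> monoms m n"
    and dom: "\<And>i j. (i, j) \<in> keys u \<Longrightarrow> \<exists>k\<le>i. (k, j) \<in> keys v"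
  shows "v \<in> N"
  using u dom
proof (induction "card (keys u - keys v)" arbitrary: u rule: less_induct)
  case less
  show ?case
  proof (cases "keys u \<subseteq> keys v")
    case True
    then show ?thesis using radical_monomial_support[OF rad J up] less.prems(1) v by blast
  next
    case False
    then obtain i j where ij: "(i, j) \<in> keys u" "(i, j) \<notin> keys v" by auto
    with less.prems(2) obtain k where k: "k \<le> i" "(k, j) \<in> keys v" by blast
    then have "k < i" "1 \<le> k" using ij v by (auto simp: monoms_def le_less)
    then obtain u' where u': "u' \<in> N" "keys u' = insert (k, j) (keys u - {(i, j)})"
      using borel_exchange[OF bor J N less.prems(1) ij(1)] by metis
    have "card (keys u' - keys v) < card (keys u - keys v)"
      by (rule psubset_card_mono) (use u' k ij in auto)
    then show ?thesis
      by (rule less.hyps) (use u' k less.prems(2) in auto)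
  qed
qed


section \<open>Ideals with coprime leading monomials\<close>

lemma mdeg_superset:
  assumes "finite X" "keys u \<subseteq> X"
  shows "mdeg u = (\<Sum>x\<in>X. single (snd x) (lookup u x))"
proof -
  have "mdeg u = (\<Sum>x\<in>keys u. single (snd x) (lookup u x))"
    by (simp add: mdeg_def case_prod_unfold)
  also have "\<dots> = (\<Sum>x\<in>X. single (snd x) (lookup u x))"
    by (rule sum.mono_neutral_left) (use assms in \<open>auto simp: in_keys_iff\<close>)
  finally show ?thesis .
qed

lemma mdeg_add: "mdeg (u + v) = mdeg u + mdeg v"
proof -
  have "mdeg (u + v) = (\<Sum>x\<in>keys u \<union> keys v. single (snd x) (lookup (u + v) x))"
    by (rule mdeg_superset) (auto simp: keys_add_monom)
  also have "\<dots> = (\<Sum>x\<in>keys u \<union> keys v. single (snd x) (lookup u x)) + (\<Sum>x\<in>keys u \<union> keys v. single (snd x) (lookup v x))"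
    by (simp add: lookup_add single_add sum.distrib)
  also have "\<dots> = mdeg u + mdeg v"
    by (simp add: mdeg_superset[symmetric])
  finally show ?thesis .
qed

lemma mdeg_sum: "mdeg (\<Sum>x\<in>A. f x) = (\<Sum>x\<in>A. mdeg (f x))"
  by (induction A rule: infinite_finite_induct) (auto simp: mdeg_add, simp_all add: mdeg_def)

lemma mdeg_single: "mdeg (single (i, j) d) = single j d"
  by (simp add: mdeg_def)

lemma graded_part_eq: "graded_part m n a = {p. keys p \<subseteq> {u \<in> monoms m n. mdeg u = a}}"
  by (auto simp: graded_part_def polys_def)

lemma graded_part_mult:
  assumes "p \<in> graded_part m n a" "q \<in> graded_part m n b"
  shows "p * q \<in> graded_part m n (a + b)"
  using assms keys_mult[of p q] by (fastforce simp: graded_part_eq mdeg_add)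

lemma lookup_mdeg: "lookup (mdeg u) j = (\<Sum>x\<in>keys u. if snd x = j then lookup u x else 0)"
  by (simp add: mdeg_def case_prod_unfold lookup_sum lookup_single when_def)

lemma lookup_mdeg_rows:
  assumes "u \<in> monoms m n"
  shows "lookup (mdeg u) j = (\<Sum>i = 1..m. lookup u (i, j))"
proof -
  have "lookup (mdeg u) j = (\<Sum>x\<in>{x\<in>keys u. snd x = j}. lookup u x)"
    by (simp add: lookup_mdeg sum.inter_filter)
  also have "\<dots> = (\<Sum>x\<in>(\<lambda>i. (i, j)) ` {1..m}. lookup u x)"
  proof (rule sum.mono_neutral_left)
    show "{x \<in> keys u. snd x = j} \<subseteq> (\<lambda>i. (i, j)) ` {1..m}"
      using assms unfolding monoms_def by force
  qed (auto simp: in_keys_iff)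
  also have "\<dots> = (\<Sum>i = 1..m. lookup u (i, j))"
    by (simp add: sum.reindex inj_on_def)
  finally show ?thesis .
qed

lemma finite_monoms_mdeg: "finite {u \<in> monoms m n. mdeg u = a}"
proof -
  let ?F = "\<lambda>u. \<lambda>x\<in>{1..m} \<times> {1..n}. lookup u x"
  have "?F ` {u \<in> monoms m n. mdeg u = a} \<subseteq> (\<Pi>\<^sub>E x\<in>{1..m} \<times> {1..n}. {..lookup a (snd x)})"
  proof (rule image_subsetI, rule PiE_I)
    fix u x assume u: "u \<in> {u \<in> monoms m n. mdeg u = a}" and x: "x \<in> {1..m} \<times> {1..n}"
    obtain i j where ij: "x = (i, j)" "i \<in> {1..m}" using x by auto
    have "lookup u (i, j) \<le> (\<Sum>i = 1..m. lookup u (i, j))"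
      by (rule member_le_sum) (use ij in auto)
    then show "?F u x \<in> {..lookup a (snd x)}"
      using u x ij lookup_mdeg_rows[of u m n j] by auto
  qed auto
  moreover have "finite (\<Pi>\<^sub>E x\<in>{1..m} \<times> {1..n}. {..lookup a (snd x)})"
    by (rule finite_PiE) auto
  moreover have "inj_on ?F {u \<in> monoms m n. mdeg u = a}"
  proof (rule inj_onI, rule poly_mapping_eqI)
    fix u v x assume u: "u \<in> {u \<in> monoms m n. mdeg u = a}" and v: "v \<in> {u \<in> monoms m n. mdeg u = a}"
      and eq: "?F u = ?F v"
    show "lookup u x = lookup v x"
    proof (cases "x \<in> {1..m} \<times> {1..n}")
      case True
      then show ?thesis using fun_cong[OF eq, of x] by (simp only: restrict_apply if_True)
    next
      case False
      then have "x \<notin> keys u" "x \<notin> keys v" using u v by (auto simp: monoms_def)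
      then show ?thesis by (simp add: in_keys_iff)
    qed
  qed
  ultimately show ?thesis
    by (meson finite_imageD finite_subset)
qed

text \<open>Coordinates with respect to \<open>C\<close> are unique, so a vector in both spans uses
  only basis vectors common to \<open>A\<close> and \<open>B\<close>.\<close>

lemma span_Int_independent:
  assumes C: "mpv.independent C" and AB: "A \<subseteq> C" "B \<subseteq> C"
    and p: "p \<in> mpv.span A" "p \<in> mpv.span B"
  shows "p \<in> mpv.span (A \<inter> B)"
proof -
  let ?r = "mpv.representation C p"
  have "?r = mpv.representation A p" "?r = mpv.representation B p"
    using mpv.representation_extend[OF C] AB p by metis+
  then have AB_r: "b \<in> A \<inter> B" if "?r b \<noteq> 0" for b
    using that mpv.representation_ne_zero by (metis IntI)
  have "p \<in> mpv.span C"
    using p(1) mpv.span_mono[OF AB(1)] by blast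
  then have "(\<Sum>b | ?r b \<noteq> 0. scale (?r b) b) = p"
    by (rule mpv.sum_nonzero_representation_eq[OF C])
  moreover have "(\<Sum>b | ?r b \<noteq> 0. scale (?r b) b) \<in> mpv.span (A \<inter> B)"
  proof (intro mpv.span_sum mpv.span_scale)
    fix b assume "b \<in> {b. ?r b \<noteq> 0}"
    then have "b \<in> A \<inter> B" by (intro AB_r) simp
    then show "b \<in> mpv.span (A \<inter> B)" by (rule mpv.span_base)
  qed
  ultimately show ?thesis by simp
qed

text \<open>Homogeneity is carried along because the basis built from these polynomials has to
  respect the multigrading.\<close>

definition hleads :: "nat \<Rightarrow> nat \<Rightarrow> (monom \<Rightarrow> nat) \<Rightarrow> 'k::field mpoly \<Rightarrow> monom \<Rightarrow> bool" where
  "hleads m n w p u \<longleftrightarrow> leads w p u \<and> p \<in> graded_part m n (mdeg u)"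

text \<open>Only the product of the two leading terms reaches weight \<open>w u + w v\<close>, so
  nothing can cancel it.\<close>

lemma leads_mult:
  assumes add: "\<And>u v. w (u + v) = w u + w v" and p: "leads w p u" and q: "leads w q v"
  shows "leads w (p * q) (u + v)"
proof -
  have le: "w a + w b < w u + w v" if "a \<in> keys p" "b \<in> keys q" "(a, b) \<noteq> (u, v)" for a b
    using p q that unfolding leads_def
    by (metis (no_types, lifting) add_less_mono add_less_cancel_left add_less_cancel_right)
  have "lookup (p * q) (u + v) = (\<Sum>a\<in>keys p. \<Sum>b\<in>keys q. lookup p a * (lookup q b when u + v = a + b))"
    unfolding lookup_mult
    by (subst Sum_any.expand_superset[of "keys p"], force simp: in_keys_iff, force simp: in_keys_iff,
        intro sum.cong refl, subst Sum_any.expand_superset[of "keys q"])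
       (force simp: in_keys_iff sum_distrib_left)+
  also have "\<dots> = (\<Sum>a\<in>keys p. \<Sum>b\<in>keys q. if (a, b) = (u, v) then lookup p u * lookup q v else 0)"
  proof (intro sum.cong refl)
    fix a b assume ab: "a \<in> keys p" "b \<in> keys q"
    show "lookup p a * (lookup q b when u + v = a + b) = (if (a, b) = (u, v) then lookup p u * lookup q v else 0)"
      using le[OF ab] add[of u v] add[of a b] by (auto simp: when_def)
  qed
  also have "\<dots> = lookup p u * lookup q v"
  proof -
    have "(\<Sum>b\<in>keys q. if (a, b) = (u, v) then lookup p u * lookup q v else 0) =
      (if a = u then lookup p u * lookup q v else 0)" for a
      using q by (auto simp: leads_def in_keys_iff)
    then show ?thesis using p by (auto simp: leads_def in_keys_iff)
  qed
  finally have "lookup (p * q) (u + v) \<noteq> 0"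
    using p q by (simp add: leads_def)
  moreover have "w x < w (u + v)" if x: "x \<in> keys (p * q)" "x \<noteq> u + v" for x
  proof -
    obtain a b where ab: "x = a + b" "a \<in> keys p" "b \<in> keys q"
      using x(1) keys_mult[of p q] by blast
    then show ?thesis
      using le[of a b] x(2) by (auto simp: add)
  qed
  ultimately show ?thesis by (simp add: leads_def)
qed

lemma hleads_mult:
  assumes "\<And>u v. w (u + v) = w u + w v" "hleads m n w p u" "hleads m n w q v"
  shows "hleads m n w (p * q) (u + v)"
  using assms by (auto simp: hleads_def mdeg_add intro: leads_mult graded_part_mult)

lemma hleads_monom_poly: "u \<in> monoms m n \<Longrightarrow> hleads m n w (monom_poly u) u"
  by (simp add: hleads_def leads_monom_poly graded_part_eq)

lemma hleads_prod:
  assumes "\<And>u v. w (u + v) = w u + w v" "\<And>l. l \<in> A \<Longrightarrow> hleads m n w (p l) (u l)"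
  shows "hleads m n w (\<Prod>l\<in>A. p l) (\<Sum>l\<in>A. u l)"
  using assms(2)
  by (induction A rule: infinite_finite_induct)
    (auto simp: assms(1) intro!: hleads_mult simp flip: monom_poly_0 intro: hleads_monom_poly)

lemma graded_part_polys: "p \<in> graded_part m n a \<Longrightarrow> p \<in> polys m n"
  by (simp add: graded_part_def)

text \<open>Takes the place of a Groebner basis computation: coprimality yields directly a basis of
  the polynomial ring adapted to the ideal. Squarefreeness lets divisibility by \<open>L l\<close>
  be tested on supports.\<close>

locale coprime_leading =
  fixes m n :: nat and w :: "monom \<Rightarrow> nat" and A :: "'e set"
    and f :: "'e \<Rightarrow> 'k::field mpoly" and L :: "'e \<Rightarrow> monom"
  assumes w_add: "w (u + v) = w u + w v"
    and fin: "finite A"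
    and f_leads: "l \<in> A \<Longrightarrow> hleads m n w (f l) (L l)"
    and squarefree: "l \<in> A \<Longrightarrow> lookup (L l) x \<le> 1"
    and nontrivial: "l \<in> A \<Longrightarrow> L l \<noteq> 0"
    and coprime: "l \<in> A \<Longrightarrow> k \<in> A \<Longrightarrow> l \<noteq> k \<Longrightarrow> keys (L l) \<inter> keys (L k) = {}"
begin

text \<open>The largest power of the squarefree monomial \<open>L l\<close> that divides
  \<open>u\<close>.\<close>

definition expo :: "'e \<Rightarrow> monom \<Rightarrow> nat" where
  "expo l u = Min (lookup u ` keys (L l))"

definition lead_part :: "monom \<Rightarrow> monom" where
  "lead_part u = (\<Sum>l\<in>A. \<Sum>x\<in>keys (L l). single x (expo l u))"

text \<open>
  Write a monomial as a power product of the \<open>L l\<close> times a cofactor divisible by no \<open>L l\<close>, and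
  replace each \<open>L l\<close> by \<open>f l\<close>. Coprimality makes the factorisation unique, so multiplication by
  \<open>L l\<close> becomes multiplication by \<open>f l\<close>.
\<close>

definition lift :: "monom \<Rightarrow> 'k mpoly" where
  "lift u = (\<Prod>l\<in>A. f l ^ expo l u) * monom_poly (u - lead_part u)"

definition initial_monoms :: "monom set" where
  "initial_monoms = {u \<in> monoms m n. \<exists>l\<in>A. keys (L l) \<subseteq> keys u}"

lemma keys_L_nonempty: "l \<in> A \<Longrightarrow> keys (L l) \<noteq> {}"
  using nontrivial by (metis keys_eq_empty)

lemma L_eq: "l \<in> A \<Longrightarrow> L l = (\<Sum>x\<in>keys (L l). single x 1)"
proof (rule poly_mapping_eqI)
  fix x assume "l \<in> A"
  then show "lookup (L l) x = lookup (\<Sum>x\<in>keys (L l). single x 1) x"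
    using squarefree[of l x] by (auto simp: lookup_sum lookup_single when_def in_keys_iff)
qed

lemma lookup_lead_part:
  "lookup (lead_part u) x = (\<Sum>l\<in>A. if x \<in> keys (L l) then expo l u else 0)"
  by (simp add: lead_part_def lookup_sum lookup_single when_def)

lemma lead_part_le: "lookup (lead_part u) x \<le> lookup u x"
proof (cases "\<exists>l\<in>A. x \<in> keys (L l)")
  case True
  then obtain l where l: "l \<in> A" "x \<in> keys (L l)" by blast
  have "x \<notin> keys (L k)" if "k \<in> A - {l}" for k
    using coprime[OF l(1), of k] that l(2) by blast
  then have "lookup (lead_part u) x = (\<Sum>k\<in>{l}. if x \<in> keys (L k) then expo k u else 0)"
    unfolding lookup_lead_part by (intro sum.mono_neutral_right) (use fin l in auto)
  then show ?thesis using l by (simp add: expo_def)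
next
  case False
  then have "lookup (lead_part u) x = 0"
    unfolding lookup_lead_part by (intro sum.neutral) auto
  then show ?thesis by simp
qed

lemma lead_part_split: "u = lead_part u + (u - lead_part u)"
  by (rule monom_le_split) (rule lead_part_le)

text \<open>Multiplication by \<open>L k\<close> raises every exponent on the support of
  \<open>L k\<close> by 1 and, by coprimality, none on the other supports.\<close>

lemma expo_add:
  assumes "l \<in> A" "k \<in> A"
  shows "expo l (u + L k) = expo l u + (if l = k then 1 else 0)"
proof -
  have "lookup (u + L k) x = lookup u x + (if l = k then 1 else 0)" if "x \<in> keys (L l)" for x
  proof (cases "l = k")
    case True
    then show ?thesis
      using that squarefree[OF assms(2), of x] by (auto simp: lookup_add in_keys_iff)
  next
    case False
    then have "x \<notin> keys (L k)"
      using that coprime[OF assms] by blast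
    with False show ?thesis by (simp add: lookup_add in_keys_iff)
  qed
  then have "lookup (u + L k) ` keys (L l) = (\<lambda>d. d + (if l = k then 1 else 0)) ` lookup u ` keys (L l)"
    by (auto simp: image_image)
  then show ?thesis
    unfolding expo_def
    by (simp only:) (rule mono_Min_commute[symmetric], use keys_L_nonempty assms in \<open>auto simp: mono_def\<close>)
qed

lemma lead_part_add: "k \<in> A \<Longrightarrow> lead_part (u + L k) = lead_part u + L k"
proof -
  assume k: "k \<in> A"
  have "lead_part (u + L k) = (\<Sum>l\<in>A. (\<Sum>x\<in>keys (L l). single x (expo l u)) + (if l = k then L k else 0))"
    unfolding lead_part_def
  proof (rule sum.cong[OF refl])
    fix l assume l: "l \<in> A"
    show "(\<Sum>x\<in>keys (L l). single x (expo l (u + L k))) = (\<Sum>x\<in>keys (L l). single x (expo l u)) + (if l = k then L k else 0)"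
      unfolding expo_add[OF l k]
      by (cases "l = k") (simp_all only: single_add sum.distrib if_True if_False simp_thms add_0_right L_eq[OF k, symmetric])
  qed
  then show ?thesis
    using k fin by (simp add: sum.distrib lead_part_def)
qed

text \<open>The cofactor does not change, since \<open>lead_part\<close> grows by \<open>L k\<close>
  as well.\<close>

lemma lift_add: "k \<in> A \<Longrightarrow> lift (u + L k) = f k * lift u"
proof -
  assume k: "k \<in> A"
  have "(\<Prod>l\<in>A. f l ^ expo l (u + L k)) = (\<Prod>l\<in>A. f l ^ expo l u * (if l = k then f k else 1))"
    by (rule prod.cong) (auto simp: expo_add k)
  also have "\<dots> = (\<Prod>l\<in>A. f l ^ expo l u) * f k"
    using k fin by (simp add: prod.distrib)
  finally show ?thesis
    using k by (simp add: lift_def lead_part_add mult_ac)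
qed

lemma lift_leads:
  assumes "u \<in> monoms m n" shows "hleads m n w (lift u) u"
proof -
  have power: "hleads m n w (f l ^ d) (\<Sum>x\<in>keys (L l). single x d)" if "l \<in> A" for l d
  proof (induction d)
    case 0
    show ?case using hleads_monom_poly[of 0 m n w] by (simp add: monom_poly_0)
  next
    case (Suc d)
    have "(\<Sum>x\<in>keys (L l). single x (Suc d)) = L l + (\<Sum>x\<in>keys (L l). single x d)"
      using L_eq[OF that] by (metis (no_types, lifting) plus_1_eq_Suc single_add sum.cong sum.distrib)
    then show ?case
      using hleads_mult[OF w_add f_leads[OF that] Suc] by simp
  qed
  have "u - lead_part u \<in> monoms m n"
    using assms lead_part_split[of u] monoms_add by metis
  then have "hleads m n w (lift u) (lead_part u + (u - lead_part u))"
    unfolding lift_def lead_part_def[of u]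
    by (intro hleads_mult hleads_prod w_add power hleads_monom_poly) (auto simp: lead_part_def)
  then show ?thesis by (simp flip: lead_part_split)
qed

lemma lift_independent: "inj_on lift (monoms m n)" "mpv.independent (lift ` monoms m n)"
  using leads_independent[of "monoms m n" w lift] lift_leads by (auto simp: hleads_def)

text \<open>Triangularity: \<open>lift u\<close> is a nonzero multiple of \<open>u\<close> plus
  monomials of the same degree and smaller weight. Weights are natural numbers, so the elimination
  ends.\<close>

lemma monom_poly_in_span:
  assumes "u \<in> monoms m n"
  shows "monom_poly u \<in> mpv.span (lift ` {v \<in> monoms m n. mdeg v = mdeg u})"
  using assms
proof (induction "w u" arbitrary: u rule: less_induct)
  case less
  have lead: "hleads m n w (lift u) u" by (rule lift_leads[OF less.prems])
  let ?S = "mpv.span (lift ` {v \<in> monoms m n. mdeg v = mdeg u})"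
  let ?r = "\<Sum>v\<in>keys (lift u) - {u}. scale (lookup (lift u) v) (monom_poly v)"
  have c: "lookup (lift u) u \<noteq> 0" using lead by (simp add: hleads_def leads_def)
  have "lift u = scale (lookup (lift u) u) (monom_poly u) + ?r"
    using c by (subst mpoly_eq_sum) (simp add: in_keys_iff sum.remove)
  then have "scale (lookup (lift u) u) (monom_poly u) = lift u - ?r" by (simp add: algebra_simps)
  moreover have "?r \<in> ?S"
  proof (intro mpv.span_sum mpv.span_scale)
    fix v assume v: "v \<in> keys (lift u) - {u}"
    then have "w v < w u" "v \<in> monoms m n" "mdeg v = mdeg u"
      using lead by (auto simp: hleads_def leads_def graded_part_eq)
    then show "monom_poly v \<in> ?S" using less.hyps[of v] by simp
  qed
  moreover have "lift u \<in> ?S" using less.prems by (auto intro: mpv.span_base)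
  ultimately have "scale (lookup (lift u) u) (monom_poly u) \<in> ?S"
    by (simp add: mpv.span_diff)
  then have "scale (inverse (lookup (lift u) u)) (scale (lookup (lift u) u) (monom_poly u)) \<in> ?S"
    by (rule mpv.span_scale)
  then show ?case using c by simp
qed

lemma graded_part_subset_span: "graded_part m n a \<subseteq> mpv.span (lift ` {v \<in> monoms m n. mdeg v = a})"
proof -
  have "graded_part m n a = mpv.span (monom_poly ` {u \<in> monoms m n. mdeg u = a})"
    by (simp add: span_monom_poly graded_part_eq)
  also have "\<dots> \<subseteq> mpv.span (lift ` {v \<in> monoms m n. mdeg v = a})"
    by (rule mpv.span_minimal) (use monom_poly_in_span in auto)
  finally show ?thesis .
qed

lemma polys_subset_span: "polys m n \<subseteq> mpv.span (lift ` monoms m n)"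
proof -
  have "polys m n = mpv.span (monom_poly ` monoms m n)"
    by (simp add: span_monom_poly polys_def)
  also have "\<dots> \<subseteq> mpv.span (lift ` monoms m n)"
  proof (rule mpv.span_minimal)
    show "monom_poly ` monoms m n \<subseteq> mpv.span (lift ` monoms m n)"
    proof (rule image_subsetI)
      fix u assume "u \<in> monoms m n"
      then show "monom_poly u \<in> mpv.span (lift ` monoms m n)"
        using monom_poly_in_span[of u] mpv.span_mono[of "lift ` {v \<in> monoms m n. mdeg v = mdeg u}" "lift ` monoms m n"]
        by blast
    qed
  qed simp
  finally show ?thesis .
qed

lemma L_monoms: "l \<in> A \<Longrightarrow> L l \<in> monoms m n"
  using f_leads[of l] by (auto simp: hleads_def leads_def graded_part_eq in_keys_iff)

lemma f_polys: "l \<in> A \<Longrightarrow> f l \<in> polys m n"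
  using f_leads[of l] by (auto simp: hleads_def graded_part_polys)

text \<open>The condition on \<open>h\<close> is linear, so it suffices to check it for
  \<open>h = lift u\<close>, where the product is the basis element of
  \<open>u + L l\<close>.\<close>

lemma mult_in_span:
  assumes l: "l \<in> A" and h: "h \<in> polys m n"
  shows "h * f l \<in> mpv.span (lift ` initial_monoms)"
proof -
  have "mpv.subspace {h. h * f l \<in> mpv.span (lift ` initial_monoms)}"
  proof (rule mpv.subspaceI)
    fix c p assume "p \<in> {h. h * f l \<in> mpv.span (lift ` initial_monoms)}"
    then have "scale c (p * f l) \<in> mpv.span (lift ` initial_monoms)"
      by (simp add: mpv.span_scale)
    then show "scale c p \<in> {h. h * f l \<in> mpv.span (lift ` initial_monoms)}"
      by (simp add: scale_def mult.assoc)
  qed (auto simp: algebra_simps mpv.span_zero mpv.span_add)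
  moreover have "lift ` monoms m n \<subseteq> {h. h * f l \<in> mpv.span (lift ` initial_monoms)}"
  proof (rule image_subsetI)
    fix u assume "u \<in> monoms m n"
    then have "u + L l \<in> initial_monoms"
      using l L_monoms by (auto simp: initial_monoms_def keys_add_monom)
    then have "f l * lift u \<in> mpv.span (lift ` initial_monoms)"
      using lift_add[OF l, of u] mpv.span_base by (metis imageI)
    then show "lift u \<in> {h. h * f l \<in> mpv.span (lift ` initial_monoms)}"
      by (simp add: mult.commute)
  qed
  ultimately have "mpv.span (lift ` monoms m n) \<subseteq> {h. h * f l \<in> mpv.span (lift ` initial_monoms)}"
    by (intro mpv.span_minimal)
  then show ?thesis using h polys_subset_span by blast
qed

lemma genideal_subset_span: "genideal (poly_ring m n) (f ` A) \<subseteq> mpv.span (lift ` initial_monoms)"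
proof -
  let ?W = "{\<Sum>l\<in>A. h l * f l |h. \<forall>l. h l \<in> polys m n}"
  have "genideal (poly_ring m n) (f ` A) \<subseteq> ?W"
  proof (rule genideal_least_poly_ring)
    show "ideal ?W (poly_ring m n)"
      unfolding ideal_poly_ring_iff
    proof (intro conjI ballI)
      show "?W \<subseteq> polys m n"
      proof safe
        fix h :: "'e \<Rightarrow> 'k mpoly" assume "\<forall>l. h l \<in> polys m n"
        then have "(\<Sum>l\<in>B. h l * f l) \<in> polys m n" if "B \<subseteq> A" for B
          using that by (induction B rule: infinite_finite_induct) (auto simp: polys_closed f_polys)
        then show "(\<Sum>l\<in>A. h l * f l) \<in> polys m n" by blast
      qed
      have "(\<Sum>l\<in>A. 0 * f l) \<in> ?W" by (intro CollectI exI[of _ "\<lambda>_. 0"]) auto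
      then show "0 \<in> ?W" by simp
    next
      fix p q assume "p \<in> ?W" "q \<in> ?W"
      then obtain h h' where "p = (\<Sum>l\<in>A. h l * f l)" "\<forall>l. h l \<in> polys m n"
        "q = (\<Sum>l\<in>A. h' l * f l)" "\<forall>l. h' l \<in> polys m n" by blast
      then show "p + q \<in> ?W"
        by (intro CollectI exI[of _ "\<lambda>l. h l + h' l"]) (auto simp: polys_closed algebra_simps sum.distrib)
    next
      fix p q :: "'k mpoly" assume "p \<in> ?W" "q \<in> polys m n"
      then obtain h where "p = (\<Sum>l\<in>A. h l * f l)" "\<forall>l. h l \<in> polys m n" by blast
      with \<open>q \<in> polys m n\<close> show "q * p \<in> ?W"
        by (intro CollectI exI[of _ "\<lambda>l. q * h l"]) (auto simp: polys_closed sum_distrib_left mult.assoc)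
    qed
    show "f ` A \<subseteq> ?W"
    proof (rule image_subsetI)
      fix k assume k: "k \<in> A"
      have "(\<Sum>l\<in>A. (if l = k then 1 else 0) * f l) = f k"
        using k fin by (simp add: if_distrib[of "\<lambda>x. x * _"] cong: if_cong)
      then show "f k \<in> ?W"
        by (intro CollectI exI[of _ "\<lambda>l. if l = k then 1 else 0"]) auto
    qed
  qed
  also have "?W \<subseteq> mpv.span (lift ` initial_monoms)"
    by (auto intro!: mpv.span_sum mult_in_span)
  finally show ?thesis .
qed

lemma lift_in_genideal:
  assumes "u \<in> initial_monoms" shows "lift u \<in> genideal (poly_ring m n) (f ` A)"
proof -
  from assms obtain l where l: "l \<in> A" "keys (L l) \<subseteq> keys u" and u: "u \<in> monoms m n"
    by (auto simp: initial_monoms_def)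
  have "lookup (L l) x \<le> lookup u x" for x
  proof (cases "x \<in> keys (L l)")
    case True
    then have "x \<in> keys u" using l(2) by blast
    then show ?thesis using squarefree[OF l(1), of x] by (simp add: in_keys_iff)
  qed (simp add: in_keys_iff)
  then have "u = L l + (u - L l)" by (rule monom_le_split)
  then have *: "u = (u - L l) + L l" by (simp add: add.commute)
  then have "u - L l \<in> monoms m n" using u monoms_add by metis
  then have "lift (u - L l) \<in> polys m n"
    using lift_leads[of "u - L l"] graded_part_polys unfolding hleads_def by blast
  moreover have gens: "f ` A \<subseteq> polys m n" using f_polys by blast
  ultimately have "lift (u - L l) * f l \<in> genideal (poly_ring m n) (f ` A)"
    using genideal_ideal_poly_ring[OF gens] genideal_superset_poly_ring[OF gens] l(1)
    by (auto simp: ideal_poly_ring_iff)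
  then show ?thesis
    by (subst *) (simp add: lift_add[OF l(1)] mult.commute)
qed

text \<open>The ideal and the graded part lie in spans of subfamilies of the same independent family
  \<open>lift\<close>, so their intersection lies in the span of the common members. This avoids
  splitting elements of the ideal into homogeneous components.\<close>

theorem dim_genideal:
  "mpv.dim (genideal (poly_ring m n) (f ` A) \<inter> graded_part m n a) = card {u \<in> initial_monoms. mdeg u = a}"
proof (rule mpv.dim_unique)
  let ?I = "genideal (poly_ring m n) (f ` A) \<inter> graded_part m n a"
  let ?B = "lift ` {u \<in> initial_monoms. mdeg u = a}"
  have sub: "initial_monoms \<subseteq> monoms m n" by (auto simp: initial_monoms_def)
  show "?B \<subseteq> ?I"
    using lift_in_genideal lift_leads sub by (auto simp: hleads_def)
  have Int: "lift ` initial_monoms \<inter> lift ` {v \<in> monoms m n. mdeg v = a} = ?B"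
    using sub inj_on_image_Int[OF lift_independent(1), of initial_monoms "{v \<in> monoms m n. mdeg v = a}"]
    by (auto intro!: arg_cong[of _ _ "\<lambda>X. lift ` X"])
  show "?I \<subseteq> mpv.span ?B"
    using span_Int_independent[OF lift_independent(2), of "lift ` initial_monoms" "lift ` {v \<in> monoms m n. mdeg v = a}"]
      genideal_subset_span graded_part_subset_span[of a] sub
    unfolding Int by blast
  show "mpv.independent ?B"
    by (rule mpv.independent_mono[OF lift_independent(2)]) (use sub in auto)
  show "card ?B = card {u \<in> initial_monoms. mdeg u = a}"
    by (rule card_image, rule inj_on_subset[OF lift_independent(1)]) (use sub in auto)
qed

end


section \<open>Leading monomials of minors\<close>

definition weight :: "(nat \<times> nat \<Rightarrow> nat) \<Rightarrow> monom \<Rightarrow> nat" where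
  "weight wt u = (\<Sum>x\<in>keys u. lookup u x * wt x)"

lemma weight_add: "weight wt (u + v) = weight wt u + weight wt v"
  unfolding weight_def by (rule setsum_keys_plus_distrib) (simp_all add: distrib_right)

lemma weight_sum: "weight wt (\<Sum>x\<in>A. f x) = (\<Sum>x\<in>A. weight wt (f x))"
  by (induction A rule: infinite_finite_induct) (auto simp: weight_add, simp_all add: weight_def)

lemma weight_single: "weight wt (single x 1) = wt x"
  by (simp add: weight_def)

text \<open>
  The potentials \<open>a\<close>, \<open>b\<close> certify that \<open>\<rho>\<close> is the unique matching of maximal weight between
  rows and columns.
\<close>

lemma minor_hleads:
  fixes a b :: "nat \<Rightarrow> nat"
  assumes e: "e \<subseteq> {1..n}" and \<rho>: "bij_betw \<rho> {1..m} e"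
    and eq: "\<And>i. i \<in> {1..m} \<Longrightarrow> wt (i, \<rho> i) = a i + b (\<rho> i)"
    and less: "\<And>i j. i \<in> {1..m} \<Longrightarrow> j \<in> e \<Longrightarrow> j \<noteq> \<rho> i \<Longrightarrow> wt (i, j) < a i + b j"
  shows "hleads m n (weight wt) (minor m e :: 'k::field mpoly) (\<Sum>i = 1..m. single (i, \<rho> i) 1)"
proof -
  define s where "s = sorted_list_of_set e"
  define L where "L = (\<Sum>i = 1..m. single (i, \<rho> i) (1 :: nat))"
  define mono where "mono p = (\<Sum>i<m. single (Suc i, s ! p i) (1 :: nat))" for p
  have fin: "finite e" using e by (rule finite_subset) simp
  have card: "card e = m" using bij_betw_same_card[OF \<rho>] by simp
  have s: "bij_betw ((!) s) {..<m} e"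
    by (rule bij_betw_nth) (use fin card in \<open>simp_all add: s_def\<close>)
  have L_eq: "L = (\<Sum>i<m. single (Suc i, \<rho> (Suc i)) 1)"
    by (simp add: L_def sum.atLeast1_atMost_eq)
  let ?P = "{p. p permutes {0..<m}}"
  have finP: "finite ?P" by (rule finite_permutations) simp
  have sp: "bij_betw (\<lambda>i. s ! p i) {..<m} e" if "p \<in> ?P" for p
  proof -
    have "bij_betw p {..<m} {..<m}"
      using that permutes_imp_bij by (auto simp: atLeast0LessThan)
    then show ?thesis using bij_betw_trans[OF _ s] by (force simp: comp_def)
  qed
  have term_eq: "(\<Prod>i = 0..<m. mat m m (\<lambda>(i, j). var (i + 1) (s ! j)) $$ (i, p i)) = (monom_poly (mono p) :: 'k mpoly)"
    if "p \<in> ?P" for p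
  proof -
    have "p i < m" if "i < m" for i
      using that \<open>p \<in> ?P\<close> permutes_in_image[of p "{0..<m}" i] by simp
    then have "(\<Prod>i = 0..<m. mat m m (\<lambda>(i, j). var (i + 1) (s ! j)) $$ (i, p i)) = (\<Prod>i<m. var (Suc i) (s ! p i) :: 'k mpoly)"
      by (auto simp: atLeast0LessThan intro!: prod.cong)
    then show ?thesis by (simp add: var_def monom_poly_prod mono_def)
  qed
  have minor_eq: "minor m e = (\<Sum>p\<in>?P. single (mono p) (of_int (sign p) :: 'k))"
  proof -
    have "minor m e = (\<Sum>p\<in>?P. of_int (sign p) * (monom_poly (mono p) :: 'k mpoly))"
      unfolding minor_def s_def[symmetric]
      by (subst det_def'[where n=m]) (use term_eq in \<open>auto intro!: sum.cong\<close>)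
    then show ?thesis
      by (simp add: monom_poly_def mult_single flip: single_of_int)
  qed
  have wL: "weight wt L = (\<Sum>i<m. a (Suc i)) + (\<Sum>j\<in>e. b j)"
  proof -
    have "weight wt L = (\<Sum>i = 1..m. a i + b (\<rho> i))"
      by (simp add: L_def weight_sum weight_single eq del: One_nat_def)
    then show ?thesis
      using sum.reindex_bij_betw[OF \<rho>, of b] by (simp add: sum.distrib sum.atLeast1_atMost_eq)
  qed
  \<comment> \<open>The potentials sum to the weight of \<open>L\<close> along every permutation, so
    a single pair outside the matching makes the weight strictly smaller.\<close>
  have w_le: "weight wt (mono p) < weight wt L" if p: "p \<in> ?P" and i: "i < m" "s ! p i \<noteq> \<rho> (Suc i)" for p i
  proof -
    have le: "wt (Suc k, s ! p k) \<le> a (Suc k) + b (s ! p k)" if "k < m" for k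
      using that eq[of "Suc k"] less[of "Suc k" "s ! p k"] bij_betwE[OF sp[OF p]]
      by (cases "s ! p k = \<rho> (Suc k)") (auto intro: less_imp_le)
    have "weight wt (mono p) = (\<Sum>k<m. wt (Suc k, s ! p k))"
      by (simp add: mono_def weight_sum weight_single del: One_nat_def)
    also have "\<dots> < (\<Sum>k<m. a (Suc k) + b (s ! p k))"
      by (rule sum_strict_mono_ex1)
        (use le i less[of "Suc i" "s ! p i"] bij_betwE[OF sp[OF p]] in \<open>auto intro!: bexI[of _ i]\<close>)
    also have "\<dots> = weight wt L"
      using sum.reindex_bij_betw[OF sp[OF p], of b] by (simp add: wL sum.distrib)
    finally show ?thesis .
  qed
  have mono_L: "mono p = L \<or> weight wt (mono p) < weight wt L" if "p \<in> ?P" for p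
  proof (cases "\<forall>i<m. s ! p i = \<rho> (Suc i)")
    case True
    then show ?thesis by (simp add: mono_def L_eq)
  qed (use w_le that in blast)
  \<comment> \<open>The matching as a permutation: columns are addressed by their position in the
    sorted list \<open>s\<close>.\<close>
  define p0 where "p0 i = (if i < m then inv_into {..<m} ((!) s) (\<rho> (Suc i)) else i)" for i
  have \<rho>': "bij_betw (\<lambda>i. \<rho> (Suc i)) {..<m} e"
  proof -
    have "bij_betw Suc {..<m} {1..m}"
      by (rule bij_betwI[of _ _ _ "\<lambda>i. i - 1"]) auto
    from bij_betw_trans[OF this \<rho>] show ?thesis by (simp add: comp_def)
  qed
  have p0: "p0 \<in> ?P"
  proof -
    have "bij_betw (\<lambda>i. inv_into {..<m} ((!) s) (\<rho> (Suc i))) {..<m} {..<m}"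
      using bij_betw_trans[OF \<rho>' bij_betw_inv_into[OF s]] by (simp add: comp_def)
    then have "bij_betw p0 {..<m} {..<m}"
      by (rule bij_betw_cong[THEN iffD1, rotated]) (simp add: p0_def)
    then show ?thesis
      by (auto intro!: bij_imp_permutes simp: atLeast0LessThan p0_def split: if_splits)
  qed
  have sp0: "s ! p0 i = \<rho> (Suc i)" if "i < m" for i
  proof -
    have "\<rho> (Suc i) \<in> (!) s ` {..<m}"
      using that bij_betwE[OF \<rho>'] bij_betw_imp_surj_on[OF s] by auto
    then show ?thesis using that by (simp add: p0_def f_inv_into_f)
  qed
  have mono_p0: "mono p0 = L" using sp0 by (simp add: mono_def L_eq)
  have uniq: "p = p0" if p: "p \<in> ?P" "mono p = L" for p
  proof
    fix i
    show "p i = p0 i"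
    proof (cases "i < m")
      case True
      have "s ! p i = s ! p0 i"
        using w_le[OF p(1) True] p(2) sp0[OF True] by auto
      moreover have "p i < m" "p0 i < m"
        using p p0 True permutes_in_image[of _ "{0..<m}" i] by auto
      ultimately show ?thesis
        using bij_betw_imp_inj_on[OF s] by (auto dest: inj_onD)
    next
      case False
      then show ?thesis using p(1) by (simp add: p0_def permutes_def)
    qed
  qed
  have lookup_minor: "lookup (minor m e :: 'k mpoly) v = (\<Sum>p\<in>?P. of_int (sign p) when mono p = v)" for v
    by (simp add: minor_eq lookup_sum lookup_single)
  \<comment> \<open>Only \<open>p0\<close> contributes to \<open>L\<close>, and its sign is nonzero
    in every characteristic.\<close>
  have "lookup (minor m e :: 'k mpoly) L = (\<Sum>p\<in>{p0}. of_int (sign p) when mono p = L)"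
    unfolding lookup_minor
    by (rule sum.mono_neutral_right) (use finP p0 uniq in auto)
  then have coeff: "lookup (minor m e :: 'k mpoly) L \<noteq> 0"
    using mono_p0 by (simp add: sign_def)
  have keysE: "\<exists>p\<in>?P. v = mono p" if "v \<in> keys (minor m e :: 'k mpoly)" for v
  proof (rule ccontr)
    assume "\<not> ?thesis"
    then have "lookup (minor m e :: 'k mpoly) v = 0"
      unfolding lookup_minor by (intro sum.neutral) auto
    then show False using that by (simp add: in_keys_iff)
  qed
  have leads: "leads (weight wt) (minor m e :: 'k mpoly) L"
    unfolding leads_def using coeff keysE mono_L by blast
  have mdeg_mono: "mdeg (mono p) = (\<Sum>j\<in>e. single j 1)" if "p \<in> ?P" for p
    using sum.reindex_bij_betw[OF sp[OF that], of "\<lambda>j. single j (1 :: nat)"]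
    by (simp add: mono_def mdeg_sum mdeg_single)
  have mono_monoms: "mono p \<in> monoms m n" if "p \<in> ?P" for p
  proof -
    have "x \<in> {1..m} \<times> {1..n}" if "x \<in> keys (mono p)" for x
    proof -
      have "\<exists>i<m. (Suc i, s ! p i) = x"
      proof (rule ccontr)
        assume "\<not> ?thesis"
        then have "lookup (mono p) x = 0"
          unfolding mono_def lookup_sum lookup_single by (intro sum.neutral) auto
        then show False using that by (simp add: in_keys_iff)
      qed
      then obtain i where "i < m" "(Suc i, s ! p i) = x" by blast
      then show ?thesis using e bij_betwE[OF sp[OF \<open>p \<in> ?P\<close>]] by auto
    qed
    then show ?thesis by (auto simp: monoms_def)
  qed
  have "keys (minor m e :: 'k mpoly) \<subseteq> {u \<in> monoms m n. mdeg u = mdeg L}"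
  proof
    fix v assume "v \<in> keys (minor m e :: 'k mpoly)"
    then obtain p where "p \<in> ?P" "v = mono p" using keysE by blast
    then show "v \<in> {u \<in> monoms m n. mdeg u = mdeg L}"
      using mdeg_mono[of p] mdeg_mono[OF p0] mono_monoms[of p] mono_p0 by simp
  qed
  then have "(minor m e :: 'k mpoly) \<in> graded_part m n (mdeg L)"
    by (simp add: graded_part_eq)
  with leads show ?thesis by (simp add: hleads_def L_def)
qed


section \<open>Counting column monomials\<close>

definition exps :: "nat set \<Rightarrow> nat \<Rightarrow> (nat \<Rightarrow> nat) set" where
  "exps R a = {v. (\<forall>i. i \<notin> R \<longrightarrow> v i = 0) \<and> sum v R = a}"

lemma finite_exps: "finite R \<Longrightarrow> finite (exps R a)"
proof -
  assume R: "finite R"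
  have "exps R a \<subseteq> {v. \<forall>i. (i \<in> R \<longrightarrow> v i \<in> {..a}) \<and> (i \<notin> R \<longrightarrow> v i = 0)}"
    using R by (auto simp: exps_def intro: member_le_sum)
  then show ?thesis
    by (rule finite_subset) (rule finite_set_of_finite_funs[OF R], simp)
qed

lemma card_exps_0: "finite R \<Longrightarrow> card (exps R 0) = 1"
proof -
  assume "finite R"
  then have "exps R 0 = {\<lambda>_. 0}" by (auto simp: exps_def)
  then show ?thesis by simp
qed

text \<open>A monomial either avoids the variable \<open>r\<close> or is divisible by it; dividing
  by \<open>r\<close> once gives the second summand.\<close>

lemma card_exps_insert:
  assumes R: "finite R" "r \<notin> R"
  shows "card (exps (insert r R) (Suc a)) = card (exps R (Suc a)) + card (exps (insert r R) a)"
proof -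
  let ?h = "\<lambda>v :: nat \<Rightarrow> nat. v(r := Suc (v r))"
  have sum_upd: "(\<Sum>x\<in>R. if x = r then b x else v x) = sum v R" for v b :: "nat \<Rightarrow> nat"
    by (rule sum.cong) (use R in auto)
  have "exps (insert r R) (Suc a) = exps R (Suc a) \<union> ?h ` exps (insert r R) a"
  proof (intro equalityI subsetI)
    fix v assume v: "v \<in> exps (insert r R) (Suc a)"
    show "v \<in> exps R (Suc a) \<union> ?h ` exps (insert r R) a"
    proof (cases "v r")
      case 0
      then have "v i = 0" if "i \<notin> R" for i
        using v that by (cases "i = r") (auto simp: exps_def)
      then show ?thesis using v R 0 by (auto simp: exps_def)
    next
      case (Suc b)
      then have "v(r := b) \<in> exps (insert r R) a" "v = ?h (v(r := b))"
        using v R by (auto simp: exps_def sum_upd)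
      then show ?thesis by blast
    qed
  next
    fix v assume "v \<in> exps R (Suc a) \<union> ?h ` exps (insert r R) a"
    then show "v \<in> exps (insert r R) (Suc a)"
      using R by (auto simp: exps_def sum_upd)
  qed
  moreover have "exps R (Suc a) \<inter> ?h ` exps (insert r R) a = {}"
    using R by (auto simp: exps_def)
  moreover have "inj_on ?h (exps (insert r R) a)"
  proof (rule inj_onI)
    fix v v' assume "?h v = ?h v'"
    then show "v = v'"
      by (metis Suc_inject fun_upd_same fun_upd_triv fun_upd_upd)
  qed
  ultimately show ?thesis
    using R by (simp add: card_Un_disjoint finite_exps card_image)
qed

definition exps_series :: "nat set \<Rightarrow> int fps" where
  "exps_series R = Abs_fps (\<lambda>a. int (card (exps R a)))"

lemma fps_mult_one_minus_X_nth:
  fixes f :: "int fps"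
  shows "fps_nth (f * (1 - fps_X)) n = fps_nth f n - (if n = 0 then 0 else fps_nth f (n - 1))"
  by (simp add: right_diff_distrib)

lemma exps_series_eq: "finite R \<Longrightarrow> exps_series R * (1 - fps_X) ^ card R = 1"
proof (induction R rule: finite_induct)
  case empty
  have "exps {} a = (if a = 0 then {\<lambda>_. 0} else {})" for a by (auto simp: exps_def)
  then show ?case by (auto simp: exps_series_def fps_eq_iff)
next
  case (insert r R)
  have "exps_series (insert r R) * (1 - fps_X) = exps_series R"
  proof (rule fps_ext)
    fix a show "fps_nth (exps_series (insert r R) * (1 - fps_X)) a = fps_nth (exps_series R) a"
      unfolding fps_mult_one_minus_X_nth
      by (cases a) (use insert.hyps in \<open>auto simp: exps_series_def card_exps_0 card_exps_insert\<close>)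
  qed
  then show ?case using insert by (simp flip: mult.assoc)
qed

lemma one_minus_X_power_nth_0:
  "k < n \<Longrightarrow> fps_nth ((1 - fps_X :: int fps) ^ k) n = 0"
  by (induction k arbitrary: n)
    (auto simp: power_Suc2 fps_mult_one_minus_X_nth simp del: power_Suc)

lemma inverse_one_minus_X_nth:
  fixes g :: "int fps"
  assumes "g * (1 - fps_X) = 1" shows "fps_nth g n = 1"
proof (induction n)
  case 0
  show ?case using fps_mult_one_minus_X_nth[of g 0] assms by simp
next
  case (Suc n)
  then show ?case using fps_mult_one_minus_X_nth[of g "Suc n"] assms by simp
qed

lemma inverse_one_minus_X_power2_nth:
  fixes g :: "int fps"
  assumes "g * (1 - fps_X) ^ 2 = 1" shows "fps_nth g n = int n + 1"
proof -
  have 1: "fps_nth (g * (1 - fps_X)) n = 1" for n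
    by (rule inverse_one_minus_X_nth) (use assms in \<open>simp add: power2_eq_square mult.assoc\<close>)
  show ?thesis
  proof (induction n)
    case 0
    show ?case using fps_mult_one_minus_X_nth[of g 0] 1[of 0] by simp
  next
    case (Suc n)
    then show ?case using fps_mult_one_minus_X_nth[of g "Suc n"] 1[of "Suc n"] by simp
  qed
qed

text \<open>
  The series \<open>g = dual_series m d\<close> encodes the linear functional \<open>h \<mapsto> [Z\<^sup>m] (g h)\<close>. For \<open>d \<le> 1\<close> and
  \<open>k \<le> m\<close> it sends the Hilbert series \<open>1 / (1 - Z)\<^sup>k\<close> of a polynomial ring in \<open>k\<close> variables
  to \<open>1\<close> if \<open>k \<ge> m - d\<close> and to \<open>0\<close> otherwise.
\<close>

definition dual_series :: "nat \<Rightarrow> nat \<Rightarrow> int fps" where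
  "dual_series m d = (1 - fps_X) ^ (m - 1 - d) - fps_const (int (m * d)) * (1 - fps_X) ^ (m - 1)"

text \<open>The product is \<open>(1 - Z)^(k - card R)\<close>: a polynomial of degree below
  \<open>m\<close>, the geometric series, or its square.\<close>

lemma exps_series_mult_power_nth:
  assumes "finite R" "k < m" "card R \<le> k + 2"
  shows "fps_nth (exps_series R * (1 - fps_X) ^ k) m =
    (if card R \<le> k then 0 else if card R = Suc k then 1 else int m + 1)"
proof -
  have *: "exps_series R * (1 - fps_X) ^ card R = 1"
    using assms by (simp add: exps_series_eq)
  consider "card R \<le> k" | "card R = Suc k" | "card R = Suc (Suc k)" using assms(3) by linarith
  then show ?thesis
  proof cases
    case 1
    then have "(1 - fps_X :: int fps) ^ k = (1 - fps_X) ^ card R * (1 - fps_X) ^ (k - card R)"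
      by (simp flip: power_add)
    then have "exps_series R * (1 - fps_X) ^ k = (1 - fps_X) ^ (k - card R)"
      using * by (simp flip: mult.assoc)
    then show ?thesis using 1 assms by (simp add: one_minus_X_power_nth_0)
  next
    case 2
    then have "exps_series R * (1 - fps_X) ^ k * (1 - fps_X) = 1"
      using * by (simp add: mult_ac)
    then show ?thesis using 2 by (simp add: inverse_one_minus_X_nth)
  next
    case 3
    then have "exps_series R * (1 - fps_X) ^ k * (1 - fps_X) ^ 2 = 1"
      using * by (simp add: power2_eq_square mult_ac)
    then show ?thesis using 3 by (simp add: inverse_one_minus_X_power2_nth)
  qed
qed

text \<open>The first term of \<open>dual_series\<close> yields 0, 1 or \<open>m + 1\<close>. The
  last value occurs only for \<open>d = 1\<close> and \<open>card R = m\<close>; there the second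
  term subtracts \<open>m\<close>, and for fewer variables it contributes 0. This is the origin of
  the constant \<open>m * d\<close>.\<close>

lemma exps_series_dual_nth:
  assumes "finite R" "m \<ge> 2" "card R \<le> m" "d \<le> 1"
  shows "fps_nth (exps_series R * dual_series m d) m = (if m \<le> card R + d then 1 else 0)"
proof -
  have eq: "fps_nth (exps_series R * dual_series m d) m = fps_nth (exps_series R * (1 - fps_X) ^ (m - 1 - d)) m
      - int (m * d) * fps_nth (exps_series R * (1 - fps_X) ^ (m - 1)) m"
    by (simp add: dual_series_def right_diff_distrib mult.left_commute[of _ "fps_const _"])
  have "d = 0 \<or> d = 1" using assms by auto
  then show ?thesis
    unfolding eq
    by (subst (1 2) exps_series_mult_power_nth) (use assms in auto)
qed

section \<open>Functionals on the monomials of one column\<close>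

definition col_exps :: "nat \<Rightarrow> (nat \<Rightarrow> nat) set" where
  "col_exps m = {v. (\<forall>i. i \<notin> {1..m} \<longrightarrow> v i = 0) \<and> (\<Sum>i = 1..m. v i) \<le> m}"

text \<open>The subtraction is exact on \<open>col_exps\<close>; column degrees above
  \<open>m\<close> cannot reach the coefficient of \<open>Z^m\<close>.\<close>

definition col_weight :: "nat \<Rightarrow> nat \<Rightarrow> nat \<Rightarrow> int" where
  "col_weight m d a = fps_nth (dual_series m d) (m - a)"

text \<open>The functional applied to the Hilbert series of the column monomials in the class
  \<open>P\<close>.\<close>

definition class_weight :: "nat \<Rightarrow> nat \<Rightarrow> ((nat \<Rightarrow> nat) \<Rightarrow> bool) \<Rightarrow> int" where
  "class_weight m d P = (\<Sum>v\<in>{v \<in> col_exps m. P v}. col_weight m d (\<Sum>i = 1..m. v i))"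

lemma finite_col_exps: "finite (col_exps m)"
proof -
  have "col_exps m \<subseteq> (\<Union>a\<le>m. exps {1..m} a)"
    by (auto simp: col_exps_def exps_def)
  then show ?thesis
    by (rule finite_subset) (auto intro: finite_exps)
qed

text \<open>Grouped by degree, the sum is a coefficient of a Cauchy product.\<close>

lemma class_weight_support:
  assumes R: "R \<subseteq> {1..m}" and m: "m \<ge> 2" and d: "d \<le> 1"
  shows "class_weight m d (\<lambda>v. \<forall>i. i \<notin> R \<longrightarrow> v i = 0) = (if m \<le> card R + d then 1 else 0)"
proof -
  let ?S = "{v \<in> col_exps m. \<forall>i. i \<notin> R \<longrightarrow> v i = 0}"
  have fin: "finite R" using R by (rule finite_subset) simp
  have sum_eq: "(\<Sum>i = 1..m. v i) = sum v R" if "\<forall>i. i \<notin> R \<longrightarrow> v i = 0" for v :: "nat \<Rightarrow> nat"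
    by (rule sum.mono_neutral_right) (use R that in auto)
  have S: "{v \<in> ?S. (\<Sum>i = 1..m. v i) = a} = exps R a" if "a \<in> {0..m}" for a
  proof (intro equalityI subsetI)
    fix v assume "v \<in> exps R a"
    then have v: "\<forall>i. i \<notin> R \<longrightarrow> v i = 0" "sum v R = a" by (auto simp: exps_def)
    moreover have "v i = 0" if "i \<notin> {1..m}" for i
      using that R v(1) by blast
    ultimately show "v \<in> {v \<in> ?S. (\<Sum>i = 1..m. v i) = a}"
      using that sum_eq[OF v(1)] by (simp add: col_exps_def)
  next
    fix v assume v: "v \<in> {v \<in> ?S. (\<Sum>i = 1..m. v i) = a}"
    then show "v \<in> exps R a"
      using sum_eq[of v] by (simp add: exps_def)
  qed
  have "class_weight m d (\<lambda>v. \<forall>i. i \<notin> R \<longrightarrow> v i = 0)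
    = (\<Sum>a\<in>{0..m}. of_nat (card {v \<in> ?S. (\<Sum>i = 1..m. v i) = a}) * col_weight m d a)"
    unfolding class_weight_def
    by (rule sum_fun_comp) (auto simp: finite_col_exps, auto simp: col_exps_def)
  also have "\<dots> = (\<Sum>a\<in>{0..m}. int (card (exps R a)) * col_weight m d a)"
    by (rule sum.cong[OF refl]) (simp only: S)
  also have "\<dots> = fps_nth (exps_series R * dual_series m d) m"
    by (simp add: fps_mult_nth exps_series_def col_weight_def)
  also have "\<dots> = (if m \<le> card R + d then 1 else 0)"
    by (rule exps_series_dual_nth[OF fin m _ d]) (use card_mono[OF _ R] in simp)
  finally show ?thesis .
qed

lemma class_weight_diff:
  assumes "\<And>v. Q v \<Longrightarrow> P v"
  shows "class_weight m d (\<lambda>v. P v \<and> \<not> Q v) = class_weight m d P - class_weight m d Q"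
proof -
  have "{v \<in> col_exps m. P v} = {v \<in> col_exps m. P v \<and> \<not> Q v} \<union> {v \<in> col_exps m. Q v}"
    using assms by blast
  then have "class_weight m d P = class_weight m d (\<lambda>v. P v \<and> \<not> Q v) + class_weight m d Q"
    unfolding class_weight_def
    by (simp only:) (rule sum.union_disjoint, auto simp: finite_col_exps)
  then show ?thesis by simp
qed

lemma class_weight_cong:
  "(\<And>v. v \<in> col_exps m \<Longrightarrow> P v \<longleftrightarrow> Q v) \<Longrightarrow> class_weight m d P = class_weight m d Q"
  unfolding class_weight_def by (rule sum.cong) auto

text \<open>The value for the zero vector is \<open>m + 1\<close>.\<close>

definition first_row :: "nat \<Rightarrow> (nat \<Rightarrow> nat) \<Rightarrow> nat" where
  "first_row m v = (LEAST i. v i \<noteq> 0 \<or> i = Suc m)"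

lemma first_row_le: "first_row m v \<le> Suc m"
  unfolding first_row_def by (rule Least_le) simp

lemma first_row_ge_iff:
  "c \<le> Suc m \<Longrightarrow> c \<le> first_row m v \<longleftrightarrow> (\<forall>i<c. v i = 0)"
proof
  assume c: "c \<le> Suc m" "c \<le> first_row m v"
  show "\<forall>i<c. v i = 0"
  proof (intro allI impI)
    fix i assume "i < c"
    then have "i < (LEAST i. v i \<noteq> 0 \<or> i = Suc m)" using c by (simp add: first_row_def)
    then show "v i = 0" using not_less_Least by blast
  qed
next
  assume c: "c \<le> Suc m" "\<forall>i<c. v i = 0"
  have "v (first_row m v) \<noteq> 0 \<or> first_row m v = Suc m"
    unfolding first_row_def by (rule LeastI[of _ "Suc m"]) simp
  then show "c \<le> first_row m v" using c by (metis not_le)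
qed

lemma first_row_nonzero: "first_row m v \<le> m \<Longrightarrow> v (first_row m v) \<noteq> 0"
proof -
  assume "first_row m v \<le> m"
  moreover have "v (first_row m v) \<noteq> 0 \<or> first_row m v = Suc m"
    unfolding first_row_def by (rule LeastI[of _ "Suc m"]) simp
  ultimately show ?thesis by simp
qed

lemma first_row_pos: "v \<in> col_exps m \<Longrightarrow> 1 \<le> first_row m v"
  by (subst first_row_ge_iff) (auto simp: col_exps_def)

text \<open>First row at least \<open>b\<close> means support in \<open>{b..m}\<close>, that is
  \<open>m - b + 1\<close> variables, which has value 1 exactly for \<open>b \<le> d + 1\<close>.
  Differences of consecutive tails isolate the row \<open>d + 1\<close>.\<close>

lemma class_weight_first_row:
  assumes m: "m \<ge> 2" and d: "d \<le> 1" and c: "c \<in> {1..Suc m}"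
  shows "class_weight m d (\<lambda>v. first_row m v = c) = (if c = Suc d then 1 else 0)"
proof -
  have ge: "class_weight m d (\<lambda>v. b \<le> first_row m v) = (if b \<le> Suc d then 1 else 0)"
    if b: "b \<in> {1..Suc m}" for b
  proof -
    have "class_weight m d (\<lambda>v. b \<le> first_row m v) = class_weight m d (\<lambda>v. \<forall>i. i \<notin> {b..m} \<longrightarrow> v i = 0)"
    proof (rule class_weight_cong)
      fix v assume v: "v \<in> col_exps m"
      have "b \<le> first_row m v \<longleftrightarrow> (\<forall>i<b. v i = 0)"
        by (rule first_row_ge_iff) (use b in simp)
      also have "\<dots> \<longleftrightarrow> (\<forall>i. i \<notin> {b..m} \<longrightarrow> v i = 0)"
        using v by (auto simp: col_exps_def)
      finally show "b \<le> first_row m v \<longleftrightarrow> (\<forall>i. i \<notin> {b..m} \<longrightarrow> v i = 0)" .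
    qed
    also have "\<dots> = (if m \<le> card {b..m} + d then 1 else 0)"
      by (rule class_weight_support[OF _ m d]) (use b in auto)
    also have "\<dots> = (if b \<le> Suc d then 1 else 0)"
      using b m d by auto
    finally show ?thesis .
  qed
  show ?thesis
  proof (cases "c = Suc m")
    \<comment> \<open>The zero column: no further tail has to be subtracted.\<close>
    case True
    have "class_weight m d (\<lambda>v. first_row m v = c) = class_weight m d (\<lambda>v. c \<le> first_row m v)"
      unfolding True by (rule class_weight_cong) (metis first_row_le le_antisym order_refl)
    then show ?thesis using ge[OF c] True m d by auto
  next
    case False
    have "class_weight m d (\<lambda>v. first_row m v = c)
      = class_weight m d (\<lambda>v. c \<le> first_row m v \<and> \<not> Suc c \<le> first_row m v)"
      by (rule class_weight_cong) auto
    also have "\<dots> = class_weight m d (\<lambda>v. c \<le> first_row m v) - class_weight m d (\<lambda>v. Suc c \<le> first_row m v)"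
      by (rule class_weight_diff) simp
    finally show ?thesis using ge[OF c] ge[of "Suc c"] False c by auto
  qed
qed

lemma class_weight_row_0:
  assumes m: "m \<ge> 2" and r: "r \<in> {1..m}"
  shows "class_weight m 0 (\<lambda>v. v r = 0) = 0" "class_weight m 0 (\<lambda>v. v r \<noteq> 0) = 1"
proof -
  have all: "class_weight m 0 (\<lambda>v. True) = 1"
    using class_weight_support[of "{1..m}" m 0] m
    by (subst class_weight_cong[where Q="\<lambda>v. \<forall>i. i \<notin> {1..m} \<longrightarrow> v i = 0"]) (auto simp: col_exps_def)
  show zero: "class_weight m 0 (\<lambda>v. v r = 0) = 0"
    using class_weight_support[of "{1..m} - {r}" m 0] m r
    by (subst class_weight_cong[where Q="\<lambda>v. \<forall>i. i \<notin> {1..m} - {r} \<longrightarrow> v i = 0"]) (auto simp: col_exps_def)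
  show "class_weight m 0 (\<lambda>v. v r \<noteq> 0) = 1"
    using class_weight_diff[of "\<lambda>v. v r = 0" "\<lambda>_. True" m 0] all zero by simp
qed

text \<open>For \<open>d = 1\<close>, forbidding one variable still gives 1, but forbidding two
  gives 0.\<close>

lemma class_weight_row_1:
  assumes m: "m \<ge> 2" and r: "r \<in> {1..m}" "s \<in> {1..m}" "r \<noteq> s"
  shows "class_weight m 1 (\<lambda>v. v r = 0 \<and> v s = 0) = 0" "class_weight m 1 (\<lambda>v. v r \<noteq> 0 \<and> v s = 0) = 1"
proof -
  have one: "class_weight m 1 (\<lambda>v. v s = 0) = 1"
    using class_weight_support[of "{1..m} - {s}" m 1] m r
    by (subst class_weight_cong[where Q="\<lambda>v. \<forall>i. i \<notin> {1..m} - {s} \<longrightarrow> v i = 0"]) (auto simp: col_exps_def)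
  have "{1..m} - {r, s} = {1..m} - {r} - {s}" by auto
  then have card: "card ({1..m} - {r, s}) = m - 2" using r by simp
  show zero: "class_weight m 1 (\<lambda>v. v r = 0 \<and> v s = 0) = 0"
    using class_weight_support[of "{1..m} - {r, s}" m 1] m card
    by (subst class_weight_cong[where Q="\<lambda>v. \<forall>i. i \<notin> {1..m} - {r, s} \<longrightarrow> v i = 0"]) (auto simp: col_exps_def)
  have "class_weight m 1 (\<lambda>v. v r \<noteq> 0 \<and> v s = 0) = class_weight m 1 (\<lambda>v. v s = 0 \<and> \<not> (v r = 0 \<and> v s = 0))"
    by (rule class_weight_cong) auto
  also have "\<dots> = 1"
    using class_weight_diff[of "\<lambda>v. v r = 0 \<and> v s = 0" "\<lambda>v. v s = 0" m 1] one zero by simp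
  finally show "class_weight m 1 (\<lambda>v. v r \<noteq> 0 \<and> v s = 0) = 1" .
qed


section \<open>Weighted counts of monomials by classes\<close>

text \<open>The monomials seen by the functional: a finite set, since all column degrees are bounded
  and columns outside \<open>V\<close> are empty.\<close>

definition box :: "nat \<Rightarrow> nat set \<Rightarrow> monom set" where
  "box m V = {u. keys u \<subseteq> {1..m} \<times> V \<and> (\<forall>j\<in>V. (\<Sum>i = 1..m. lookup u (i, j)) \<le> m)}"

definition columns :: "nat set \<Rightarrow> monom \<Rightarrow> nat \<Rightarrow> nat \<Rightarrow> nat" where
  "columns V u = (\<lambda>j\<in>V. \<lambda>i. lookup u (i, j))"

lemma bij_columns:
  assumes "finite V"
  shows "bij_betw (columns V) (box m V) (V \<rightarrow>\<^sub>E col_exps m)"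
proof (rule bij_betwI)
  define uncol where "uncol g = Abs_poly_mapping (\<lambda>(i, j). if j \<in> V then g j i else 0)"
    for g :: "nat \<Rightarrow> nat \<Rightarrow> nat"
  have uncol: "lookup (uncol g) (i, j) = (if j \<in> V then g j i else 0)" if "g \<in> V \<rightarrow>\<^sub>E col_exps m" for g i j
  proof -
    have "{x. (case x of (i, j) \<Rightarrow> if j \<in> V then g j i else 0) \<noteq> 0} \<subseteq> {1..m} \<times> V"
    proof
      fix x assume "x \<in> {x. (case x of (i, j) \<Rightarrow> if j \<in> V then g j i else 0) \<noteq> 0}"
      then obtain i j where ij: "x = (i, j)" "j \<in> V" "g j i \<noteq> 0"
        by (cases x) (auto split: if_splits)
      moreover have "g j \<in> col_exps m" using that ij by auto
      ultimately show "x \<in> {1..m} \<times> V" by (auto simp: col_exps_def)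
    qed
    then have "finite {x. (case x of (i, j) \<Rightarrow> if j \<in> V then g j i else 0) \<noteq> 0}"
      by (rule finite_subset) (use assms in simp)
    then show ?thesis by (simp add: uncol_def)
  qed
  show "columns V \<in> box m V \<rightarrow> V \<rightarrow>\<^sub>E col_exps m"
  proof (intro funcsetI PiE_I)
    fix u j assume u: "u \<in> box m V" and j: "j \<in> V"
    have "lookup u (i, j) = 0" if "i \<notin> {1..m}" for i
      using u that by (auto simp: box_def simp flip: not_in_keys_iff_lookup_eq_zero)
    then show "columns V u j \<in> col_exps m"
      using u j by (auto simp: columns_def col_exps_def box_def)
  qed (simp add: columns_def)
  show "uncol \<in> (V \<rightarrow>\<^sub>E col_exps m) \<rightarrow> box m V"
  proof
    fix g assume g: "g \<in> V \<rightarrow>\<^sub>E col_exps m"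
    have "keys (uncol g) \<subseteq> {1..m} \<times> V"
    proof
      fix x assume x: "x \<in> keys (uncol g)"
      obtain i j where ij: "x = (i, j)" by (cases x)
      then have "j \<in> V" "g j i \<noteq> 0"
        using x uncol[OF g, of i j] by (simp_all add: in_keys_iff split: if_splits)
      moreover have "g j \<in> col_exps m" using g \<open>j \<in> V\<close> by auto
      ultimately show "x \<in> {1..m} \<times> V" using ij by (auto simp: col_exps_def)
    qed
    moreover have "(\<Sum>i = 1..m. lookup (uncol g) (i, j)) \<le> m" if "j \<in> V" for j
    proof -
      have "g j \<in> col_exps m" using g that by auto
      then show ?thesis using that by (simp add: uncol[OF g] col_exps_def)
    qed
    ultimately show "uncol g \<in> box m V" by (simp add: box_def)
  qed
  show "uncol (columns V u) = u" if u: "u \<in> box m V" for u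
  proof (rule poly_mapping_eqI)
    fix x :: "nat \<times> nat"
    obtain i j where x: "x = (i, j)" by (cases x)
    have "columns V u \<in> V \<rightarrow>\<^sub>E col_exps m"
      using \<open>columns V \<in> box m V \<rightarrow> V \<rightarrow>\<^sub>E col_exps m\<close> u by auto
    then have "lookup (uncol (columns V u)) x = (if j \<in> V then lookup u x else 0)"
      by (simp add: uncol x columns_def)
    moreover have "lookup u x = 0" if "j \<notin> V"
      using u that x by (auto simp: box_def simp flip: not_in_keys_iff_lookup_eq_zero)
    ultimately show "lookup (uncol (columns V u)) x = lookup u x" by auto
  qed
  show "columns V (uncol g) = g" if g: "g \<in> V \<rightarrow>\<^sub>E col_exps m" for g
  proof
    fix j show "columns V (uncol g) j = g j"
      using g by (cases "j \<in> V") (auto simp: columns_def uncol[OF g] PiE_iff extensional_def)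
  qed
qed

lemma finite_box: "finite V \<Longrightarrow> finite (box m V)"
  using bij_betw_finite[OF bij_columns] finite_PiE[of V "\<lambda>_. col_exps m"] finite_col_exps by blast

definition multiweight :: "nat \<Rightarrow> nat set \<Rightarrow> (nat \<Rightarrow> nat) \<Rightarrow> (nat \<Rightarrow>\<^sub>0 nat) \<Rightarrow> int" where
  "multiweight m V d a = (\<Prod>j\<in>V. col_weight m (d j) (lookup a j))"

text \<open>\<open>box\<close> is a union of full fibres of \<open>mdeg\<close>, so counts by
  multidegree determine the sum.\<close>

lemma multiweight_cong:
  assumes X: "X \<subseteq> monoms m n" and Y: "Y \<subseteq> monoms m n" and V: "finite V" "V \<subseteq> {1..n}"
    and card: "\<And>a. card {u \<in> X. mdeg u = a} = card {u \<in> Y. mdeg u = a}"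
  shows "(\<Sum>u\<in>X \<inter> box m V. multiweight m V d (mdeg u)) = (\<Sum>u\<in>Y \<inter> box m V. multiweight m V d (mdeg u))"
proof -
  let ?D = "mdeg ` box m V"
  have box_monoms: "u \<in> monoms m n" if "u \<in> box m V" for u
    using that V(2) by (auto simp: box_def monoms_def)
  have box_mdeg: "u \<in> box m V" if u: "u \<in> monoms m n" "mdeg u \<in> ?D" for u
  proof -
    obtain u' where u': "u' \<in> box m V" "mdeg u' = mdeg u" using u(2) by auto
    have rows: "(\<Sum>i = 1..m. lookup u (i, j)) = (\<Sum>i = 1..m. lookup u' (i, j))" for j
      using lookup_mdeg_rows[OF u(1), of j] lookup_mdeg_rows[OF box_monoms[OF u'(1)], of j] u'(2) by simp
    have "(i, j) \<in> {1..m} \<times> V" if ij: "(i, j) \<in> keys u" for i j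
    proof -
      have i: "i \<in> {1..m}" using u(1) ij by (auto simp: monoms_def)
      then have "lookup u (i, j) \<le> (\<Sum>i = 1..m. lookup u (i, j))"
        by (intro member_le_sum) auto
      moreover have "lookup u (i, j) \<noteq> 0" using ij by (simp add: in_keys_iff)
      ultimately have "(\<Sum>i = 1..m. lookup u' (i, j)) \<noteq> 0" unfolding rows by linarith
      then obtain k where "lookup u' (k, j) \<noteq> 0" by (meson sum.neutral)
      then have "(k, j) \<in> keys u'" by (simp add: in_keys_iff)
      then show ?thesis using u'(1) i by (auto simp: box_def)
    qed
    then show ?thesis using u'(1) rows by (auto simp: box_def)
  qed
  have *: "(\<Sum>u\<in>Z \<inter> box m V. multiweight m V d (mdeg u))
    = (\<Sum>a\<in>?D. of_nat (card {u \<in> Z. mdeg u = a}) * multiweight m V d a)" if Z: "Z \<subseteq> monoms m n" for Z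
  proof -
    have "(\<Sum>u\<in>Z \<inter> box m V. multiweight m V d (mdeg u))
      = (\<Sum>a\<in>?D. of_nat (card {u \<in> Z \<inter> box m V. mdeg u = a}) * multiweight m V d a)"
      by (rule sum_fun_comp) (auto simp: finite_box V)
    also have "\<dots> = (\<Sum>a\<in>?D. of_nat (card {u \<in> Z. mdeg u = a}) * multiweight m V d a)"
    proof (rule sum.cong[OF refl])
      fix a assume "a \<in> ?D"
      then have "{u \<in> Z \<inter> box m V. mdeg u = a} = {u \<in> Z. mdeg u = a}"
        using Z box_mdeg by auto
      then show "of_nat (card {u \<in> Z \<inter> box m V. mdeg u = a}) * multiweight m V d a
        = of_nat (card {u \<in> Z. mdeg u = a}) * multiweight m V d a" by simp
    qed
    finally show ?thesis .
  qed
  show ?thesis unfolding *[OF X] *[OF Y] card ..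
qed

text \<open>A monomial of the box is an independent choice of its columns. For a fixed vector of
  classes the sum factors over the columns, and \<open>X\<close> only selects which vectors
  occur.\<close>

lemma multiweight_class_sum:
  fixes cls :: "nat \<Rightarrow> (nat \<Rightarrow> nat) \<Rightarrow> nat"
  assumes V: "finite V" "V \<subseteq> {1..n}" and K: "\<And>j. j \<in> V \<Longrightarrow> finite (K j)"
    and cls: "\<And>j v. j \<in> V \<Longrightarrow> v \<in> col_exps m \<Longrightarrow> cls j v \<in> K j"
    and X: "\<And>u. u \<in> box m V \<Longrightarrow> u \<in> X \<longleftrightarrow> (\<lambda>j\<in>V. cls j (\<lambda>i. lookup u (i, j))) \<in> U"
  shows "(\<Sum>u\<in>X \<inter> box m V. multiweight m V d (mdeg u))
    = (\<Sum>\<kappa>\<in>U \<inter> Pi\<^sub>E V K. \<Prod>j\<in>V. class_weight m (d j) (\<lambda>v. cls j v = \<kappa> j))"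
proof -
  let ?G = "V \<rightarrow>\<^sub>E col_exps m"
  let ?c = "\<lambda>g. \<lambda>j\<in>V. cls j (g j)"
  let ?F = "\<lambda>g. \<Prod>j\<in>V. col_weight m (d j) (\<Sum>i = 1..m. g j i)"
  have finG: "finite ?G" by (rule finite_PiE) (auto simp: V finite_col_exps)
  have bij: "bij_betw (columns V) (X \<inter> box m V) {g \<in> ?G. ?c g \<in> U}"
  proof -
    have "u \<in> X \<longleftrightarrow> ?c (columns V u) \<in> U" if "u \<in> box m V" for u
      unfolding X[OF that] by (simp add: columns_def cong: restrict_cong)
    then have "columns V ` (X \<inter> box m V) = {g \<in> ?G. ?c g \<in> U}"
      unfolding bij_betw_imp_surj_on[OF bij_columns[OF V(1)], symmetric] by auto
    then show ?thesis
      using bij_betw_imp_inj_on[OF bij_columns[OF V(1), of m]]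
      by (auto simp: bij_betw_def intro: inj_on_subset)
  qed
  have "(\<Sum>u\<in>X \<inter> box m V. multiweight m V d (mdeg u)) = (\<Sum>u\<in>X \<inter> box m V. ?F (columns V u))"
  proof (rule sum.cong[OF refl])
    fix u assume "u \<in> X \<inter> box m V"
    then have "u \<in> monoms m n" using V(2) by (auto simp: box_def monoms_def)
    then show "multiweight m V d (mdeg u) = ?F (columns V u)"
      unfolding multiweight_def by (intro prod.cong) (auto simp: lookup_mdeg_rows columns_def)
  qed
  also have "\<dots> = (\<Sum>g\<in>{g \<in> ?G. ?c g \<in> U}. ?F g)"
    by (rule sum.reindex_bij_betw[OF bij])
  also have "\<dots> = (\<Sum>\<kappa>\<in>U \<inter> Pi\<^sub>E V K. \<Sum>g\<in>{g \<in> {g \<in> ?G. ?c g \<in> U}. ?c g = \<kappa>}. ?F g)"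
  proof (rule sum.group[symmetric])
    show "finite {g \<in> ?G. ?c g \<in> U}" using finG by simp
    show "finite (U \<inter> Pi\<^sub>E V K)" using V K by (intro finite_Int disjI2 finite_PiE) auto
    show "?c ` {g \<in> ?G. ?c g \<in> U} \<subseteq> U \<inter> Pi\<^sub>E V K"
    proof (intro image_subsetI IntI)
      fix g assume "g \<in> {g \<in> ?G. ?c g \<in> U}"
      then show "?c g \<in> U" "?c g \<in> Pi\<^sub>E V K" using cls by (auto simp: PiE_iff)
    qed
  qed
  also have "\<dots> = (\<Sum>\<kappa>\<in>U \<inter> Pi\<^sub>E V K. \<Prod>j\<in>V. class_weight m (d j) (\<lambda>v. cls j v = \<kappa> j))"
  proof (rule sum.cong[OF refl])
    fix \<kappa> assume \<kappa>: "\<kappa> \<in> U \<inter> Pi\<^sub>E V K"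
    have "{g \<in> {g \<in> ?G. ?c g \<in> U}. ?c g = \<kappa>} = (\<Pi>\<^sub>E j\<in>V. {v \<in> col_exps m. cls j v = \<kappa> j})"
    proof (intro equalityI subsetI)
      fix g assume "g \<in> {g \<in> {g \<in> ?G. ?c g \<in> U}. ?c g = \<kappa>}"
      then show "g \<in> (\<Pi>\<^sub>E j\<in>V. {v \<in> col_exps m. cls j v = \<kappa> j})"
        by (auto simp: PiE_iff)
    next
      fix g assume g: "g \<in> (\<Pi>\<^sub>E j\<in>V. {v \<in> col_exps m. cls j v = \<kappa> j})"
      have "?c g = \<kappa>"
      proof
        fix j show "?c g j = \<kappa> j"
          using g \<kappa> by (cases "j \<in> V") (auto simp: PiE_iff extensional_def)
      qed
      then show "g \<in> {g \<in> {g \<in> ?G. ?c g \<in> U}. ?c g = \<kappa>}"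
        using g \<kappa> by (auto simp: PiE_iff)
    qed
    then show "(\<Sum>g\<in>{g \<in> {g \<in> ?G. ?c g \<in> U}. ?c g = \<kappa>}. ?F g)
      = (\<Prod>j\<in>V. class_weight m (d j) (\<lambda>v. cls j v = \<kappa> j))"
      unfolding class_weight_def
      by (simp only:) (rule prod_sum_PiE[symmetric], auto simp: V finite_col_exps)
  qed
  finally show ?thesis .
qed

lemma multiweight_borel:
  fixes J :: "'k::field mpoly set"
  assumes m: "m \<ge> 2" and V: "finite V" "V \<subseteq> {1..n}" and d: "\<And>j. j \<in> V \<Longrightarrow> d j \<le> 1"
    and rad: "radical_ideal m n J" and bor: "borel_fixed m n J"
    and J: "J = {p. keys p \<subseteq> N}" and N: "N \<subseteq> monoms m n"
    and up: "\<And>u v. u \<in> N \<Longrightarrow> v \<in> monoms m n \<Longrightarrow> u + v \<in> N"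
  shows "(\<Sum>u\<in>(monoms m n - N) \<inter> box m V. multiweight m V d (mdeg u)) \<in> {0, 1}"
proof -
  let ?c = "\<lambda>u. \<lambda>j\<in>V. first_row m (\<lambda>i. lookup u (i, j))"
  let ?X = "monoms m n - N"
  let ?K = "\<lambda>_ :: nat. {1..Suc m}"
  \<comment> \<open>No monomial of the box in \<open>N\<close> shares its first rows with one
    outside \<open>N\<close>, so this image describes the complement exactly.\<close>
  define U where "U = ?c ` (?X \<inter> box m V)"
  have X: "u \<in> ?X \<longleftrightarrow> ?c u \<in> U" if u: "u \<in> box m V" for u
  proof
    show "?c u \<in> U" if "u \<in> ?X" using that u by (simp add: U_def)
  next
    assume "?c u \<in> U"
    then obtain u' where u': "u' \<in> ?X" "u' \<in> box m V" "?c u = ?c u'" by (auto simp: U_def)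
    have "u' \<in> N" if uN: "u \<in> N"
    proof (rule radical_borel_fixed_dominates[OF rad bor J N up uN])
      show "u' \<in> monoms m n" using u' by simp
      fix i j assume ij: "(i, j) \<in> keys u"
      then have j: "j \<in> V" and i: "i \<le> m" using u by (auto simp: box_def)
      define k where "k = first_row m (\<lambda>i. lookup u (i, j))"
      have "k = first_row m (\<lambda>i. lookup u' (i, j))"
        using fun_cong[OF u'(3), of j] j by (simp add: k_def)
      moreover have "k \<le> i"
        unfolding k_def first_row_def by (rule Least_le) (use ij in \<open>simp add: in_keys_iff\<close>)
      ultimately show "\<exists>k\<le>i. (k, j) \<in> keys u'"
        using first_row_nonzero[of m "\<lambda>i. lookup u' (i, j)"] i by (auto simp: in_keys_iff)
    qed
    moreover have "u \<in> monoms m n" using u V(2) by (auto simp: box_def monoms_def)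
    ultimately show "u \<in> ?X" using u' by blast
  qed
  \<comment> \<open>The only vector of first rows that the functional does not kill.\<close>
  define \<kappa>0 where "\<kappa>0 = (\<lambda>j\<in>V. Suc (d j))"
  have finite: "finite (U \<inter> Pi\<^sub>E V ?K)" using V by (intro finite_Int disjI2 finite_PiE) auto
  have "(\<Sum>u\<in>?X \<inter> box m V. multiweight m V d (mdeg u))
    = (\<Sum>\<kappa>\<in>U \<inter> Pi\<^sub>E V ?K. \<Prod>j\<in>V. class_weight m (d j) (\<lambda>v. first_row m v = \<kappa> j))"
    by (rule multiweight_class_sum[where cls="\<lambda>_. first_row m", OF V])
      (use X in \<open>auto simp: first_row_le first_row_pos[unfolded One_nat_def]\<close>)
  also have "\<dots> = (\<Sum>\<kappa>\<in>U \<inter> Pi\<^sub>E V ?K. if \<kappa> = \<kappa>0 then 1 else 0)"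
  proof (rule sum.cong[OF refl])
    fix \<kappa> assume "\<kappa> \<in> U \<inter> Pi\<^sub>E V ?K"
    then have \<kappa>: "\<kappa> \<in> Pi\<^sub>E V ?K" by simp
    have "(\<Prod>j\<in>V. class_weight m (d j) (\<lambda>v. first_row m v = \<kappa> j))
      = (\<Prod>j\<in>V. if \<kappa> j = Suc (d j) then 1 else 0)"
      using \<kappa> by (intro prod.cong refl class_weight_first_row m d) auto
    also have "\<dots> = (if \<forall>j\<in>V. \<kappa> j = Suc (d j) then 1 else 0)"
      using V by auto
    also have "(\<forall>j\<in>V. \<kappa> j = Suc (d j)) \<longleftrightarrow> \<kappa> = \<kappa>0"
      using \<kappa> by (auto simp: \<kappa>0_def PiE_iff extensional_def)
    finally show "(\<Prod>j\<in>V. class_weight m (d j) (\<lambda>v. first_row m v = \<kappa> j)) = (if \<kappa> = \<kappa>0 then 1 else 0)" .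
  qed
  also have "\<dots> \<in> {0, 1}" using finite by simp
  finally show ?thesis .
qed


section \<open>The cycle of minors\<close>

locale hypercycle =
  fixes m t :: nat
  assumes m: "m \<ge> 3" and t: "t \<ge> 1"
begin

text \<open>\<open>joint (Suc t)\<close> would be the column removed from the last edge;
  \<open>joint 0 = 1\<close> replaces it and closes the cycle.\<close>

definition joint :: "nat \<Rightarrow> nat" where "joint q = q * (m - 1) + 1"

definition edge :: "nat \<Rightarrow> nat set" where
  "edge q = (if q < t then {q * (m - 1) + 1..q * (m - 1) + m}
             else insert 1 {t * (m - 1) + 1..t * (m - 1) + m - 1})"

text \<open>
  The row-column matching that gives the leading monomial of the minor of \<open>edge q\<close>. Consecutive
  edges use different rows in their common column; for the last edge this needs a third row.
\<close>

definition match :: "nat \<Rightarrow> nat \<Rightarrow> nat" where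
  "match q i = (if q < t then q * (m - 1) + i
     else if i = 1 then t * (m - 1) + 1 else if i = 2 then 1 else t * (m - 1) + i - 1)"

definition lead :: "nat \<Rightarrow> monom" where
  "lead q = (\<Sum>i = 1..m. single (i, match q i) 1)"

text \<open>Joints occupy rows 1 and \<open>m\<close> in a regular edge, but rows 1 and 2 in the
  last one, which shifts its inner rows by one more.\<close>

definition inner_row :: "nat \<Rightarrow> nat" where
  "inner_row j = (j - 1) mod (m - 1) + (if (j - 1) div (m - 1) < t then 1 else 2)"

text \<open>On a regular edge, \<open>2 * (q + 1)\<close> for row \<open>m\<close> at the later
  joint beats \<open>2 * q\<close> at the earlier one. The weight 2 at \<open>(2, 1)\<close> serves
  the last edge. The value \<open>2 * t + 4\<close> exceeds every joint weight and ties each inner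
  column to its row.\<close>

definition wt :: "nat \<times> nat \<Rightarrow> nat" where
  "wt = (\<lambda>(i, j). if (j - 1) mod (m - 1) = 0
     then if i = m then 2 * ((j - 1) div (m - 1)) else if i = 2 \<and> j = 1 then 2 else 0
     else if i = inner_row j then 2 * t + 4 else 0)"

lemma col_div_mod:
  assumes "r < m - 1"
  shows "(q * (m - 1) + 1 + r - 1) div (m - 1) = q" "(q * (m - 1) + 1 + r - 1) mod (m - 1) = r"
  using assms by simp_all

lemma joint_div_mod [simp]: "(joint q - 1) div (m - 1) = q" "(joint q - 1) mod (m - 1) = 0"
  using m by (simp_all add: joint_def)

lemma joint_eq_iff [simp]: "joint q = joint q' \<longleftrightarrow> q = q'"
  using m by (simp add: joint_def)

lemma joint_0 [simp]: "joint 0 = 1"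
  by (simp add: joint_def)

lemma joint_eq_1_iff [simp]: "joint q = Suc 0 \<longleftrightarrow> q = 0" "Suc 0 = joint q \<longleftrightarrow> q = 0"
  using m by (auto simp: joint_def)

lemma wt_joint: "wt (i, joint q) = (if i = m then 2 * q else if i = 2 \<and> q = 0 then 2 else 0)"
  unfolding wt_def prod.case joint_div_mod by simp

lemma inner_row_col:
  "r < m - 1 \<Longrightarrow> inner_row (q * (m - 1) + 1 + r) = r + (if q < t then 1 else 2)"
  unfolding inner_row_def by (simp only: col_div_mod)

lemma wt_inner:
  assumes "1 \<le> r" "r < m - 1"
  shows "wt (i, q * (m - 1) + 1 + r) = (if i = r + (if q < t then 1 else 2) then 2 * t + 4 else 0)"
  unfolding wt_def prod.case inner_row_col[OF assms(2)] col_div_mod[OF assms(2)] using assms by simp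

lemma inner_neq_joint: "1 \<le> r \<Longrightarrow> r < m - 1 \<Longrightarrow> q * (m - 1) + 1 + r \<noteq> joint q'"
  using col_div_mod(2)[of r q] joint_div_mod(2)[of q'] by (metis not_one_le_zero)

lemma joint_Suc: "joint (Suc q) = joint q + (m - 1)"
  by (simp add: joint_def)

lemma edge_cases:
  assumes "j \<in> edge q" "q \<le> t"
  obtains "q < t" "j = joint q" | "q < t" "j = joint (Suc q)" | "q = t" "j = joint q" | "q = t" "j = 1"
    | r where "1 \<le> r" "r < m - 1" "j = q * (m - 1) + 1 + r"
proof -
  have "j = joint q \<or> (q < t \<and> j = joint (Suc q)) \<or> (q = t \<and> j = 1) \<or>
      (1 \<le> j - joint q \<and> j - joint q < m - 1 \<and> j = q * (m - 1) + 1 + (j - joint q))"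
    using assms m unfolding joint_Suc by (auto simp: edge_def joint_def split: if_splits)
  then show thesis using that assms(2) by (metis le_neq_implies_less)
qed

lemma match_bij: "q \<le> t \<Longrightarrow> bij_betw (match q) {1..m} (edge q)"
proof (cases "q < t")
  case True
  show ?thesis
    by (rule bij_betwI[where g="\<lambda>j. j - q * (m - 1)"]) (use True in \<open>auto simp: match_def edge_def\<close>)
next
  case False
  define c where "c = t * (m - 1)"
  have c: "c \<ge> 1" using m t by (simp add: c_def)
  have eq: "match q = (\<lambda>i. if i = 1 then c + 1 else if i = 2 then 1 else c + i - 1)"
    "edge q = insert 1 {c + 1..c + m - 1}"
    using False by (auto simp: match_def edge_def c_def)
  show ?thesis
    unfolding eq
    by (rule bij_betwI[where g="\<lambda>j. if j = 1 then 2 else if j = c + 1 then 1 else j + 1 - c"])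
      (use c m in auto)
qed

lemma match_inner:
  assumes "i \<in> {1..m}" "q \<le> t"
  obtains "q < t" "i = 1" "match q i = joint q" | "q < t" "i = m" "match q i = joint (Suc q)"
    | "q = t" "i = 1" "match q i = joint q" | "q = t" "i = 2" "match q i = joint 0"
    | r where "1 \<le> r" "r < m - 1" "i = r + (if q < t then 1 else 2)" "match q i = q * (m - 1) + 1 + r"
proof (cases "q < t")
  case True
  consider "i = 1" | "i = m" | "1 \<le> i - 1" "i - 1 < m - 1" "i = i - 1 + 1" using assms by force
  then show thesis
  proof cases
    case 3
    then show thesis using that(5)[of "i - 1"] True by (simp add: match_def)
  qed (use that True m in \<open>simp_all add: match_def joint_def\<close>)
next
  case False
  consider "i = 1" | "i = 2" | "1 \<le> i - 2" "i - 2 < m - 1" "i = i - 2 + 2" using assms by force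
  then show thesis
  proof cases
    case 3
    then have "match q i = q * (m - 1) + 1 + (i - 2)" using False assms(2) by (auto simp: match_def)
    then show thesis using that(5)[of "i - 2"] 3 False by simp
  qed (use that False assms(2) m in \<open>simp_all add: match_def joint_def\<close>)
qed

lemma edge_subset:
  assumes "(t + 1) * (m - 1) + 1 \<le> n" "q \<le> t"
  shows "edge q \<subseteq> {1..n}"
proof (cases "q < t")
  case True
  then have "Suc q * (m - 1) \<le> t * (m - 1)" by (intro mult_le_mono1) simp
  then show ?thesis using True assms m by (auto simp: edge_def)
qed (use assms m in \<open>auto simp: edge_def\<close>)

lemma minor_edge_hleads:
  assumes n: "(t + 1) * (m - 1) + 1 \<le> n" and q: "q \<le> t"
  shows "hleads m n (weight wt) (minor m (edge q) :: 'k::field mpoly) (lead q)"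
proof -
  \<comment> \<open>Tight on the matching: \<open>3 + (2 * t + 1)\<close> in either order on inner
    columns, \<open>(2 * q + 1) + 1\<close> at the later joint, \<open>1 + 1\<close> at column 1 of
    the last edge. The 3 beats the weight 2 at \<open>(2, 1)\<close> in \<open>edge 0\<close>;
    \<open>2 * q + 1\<close> and \<open>2 * t + 1\<close> beat the weight of row \<open>m\<close> at
    the earlier joint.\<close>
  define a where "a i = (if i = 1 then 0 else if q < t then if i = m then 2 * q + 1 else 3
    else if i = 2 then 1 else 2 * t + 1)" for i
  define b where "b j = (if j = joint q then 0 else if q < t then if j = joint (Suc q) then 1 else 2 * t + 1
    else if j = joint 0 then 1 else (3 :: nat))" for j
  have t0: "t \<noteq> 0" using t by simp
  have match_q: "match q 1 = joint q" "q < t \<Longrightarrow> match q m = joint (Suc q)" "q = t \<Longrightarrow> match q 2 = joint 0"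
    "\<And>r. match q (r + (if q < t then 1 else 2)) = q * (m - 1) + 1 + r \<or> r = 0"
    using m q by (auto simp: match_def joint_def)
  show ?thesis
    unfolding lead_def
  proof (rule minor_hleads[OF edge_subset[OF n q] match_bij[OF q], where a=a and b=b])
    fix i assume i: "i \<in> {1..m}"
    show "wt (i, match q i) = a i + b (match q i)"
      using i q
    proof (cases rule: match_inner)
      case (5 r)
      have neq: "q * (m - 1) + 1 + r \<noteq> joint q'" for q' by (rule inner_neq_joint[OF 5(1,2)])
      have "b (match q i) = (if q < t then 2 * t + 1 else 3)"
        unfolding 5(4) b_def by (simp only: neq if_False)
      moreover have "a i = (if q < t then 3 else 2 * t + 1)"
        using 5(1,2,3) by (auto simp: a_def)
      moreover have "wt (i, match q i) = 2 * t + 4"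
        unfolding 5(4) wt_inner[OF 5(1,2)] using 5(3) by simp
      ultimately show ?thesis by simp
    qed (use m t0 in \<open>simp_all only: wt_joint, simp_all add: a_def b_def del: joint_0\<close>)
  next
    fix i j assume i: "i \<in> {1..m}" and j: "j \<in> edge q" and neq: "j \<noteq> match q i"
    from j q show "wt (i, j) < a i + b j"
    proof (cases rule: edge_cases)
      case 1
      then have "i \<noteq> 1" using neq match_q by auto
      then show ?thesis using 1 by (simp add: wt_joint a_def)
    next
      case 2
      then have "i \<noteq> m" using neq match_q by auto
      then show ?thesis using 2 by (simp add: wt_joint b_def)
    next
      case 3
      then have "i \<noteq> 1" using neq match_q by auto
      then show ?thesis using 3 t0 m by (simp add: wt_joint a_def)
    next
      case 4
      then have "i \<noteq> 2" using neq match_q by auto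
      then show ?thesis using 4 t0 wt_joint[of i 0] by (simp add: b_def)
    next
      case (5 r)
      have "i \<noteq> r + (if q < t then 1 else 2)"
      proof
        assume "i = r + (if q < t then 1 else 2)"
        then show False using match_q(4)[of r] 5 neq by simp
      qed
      then have "wt (i, j) = 0"
        unfolding 5(3) wt_inner[OF 5(1,2)] by simp
      moreover have "b j > 0"
        unfolding 5(3) b_def by (simp only: inner_neq_joint[OF 5(1,2)] if_False) simp
      ultimately show ?thesis by simp
    qed
  qed
qed

lemma lookup_lead:
  "lookup (lead q) (i, j) = (if i \<in> {1..m} \<and> j = match q i then 1 else 0)"
proof -
  have "lookup (lead q) (i, j) = (\<Sum>i' = 1..m. if i' = i then if j = match q i then 1 else 0 else 0)"
    unfolding lead_def lookup_sum by (intro sum.cong) (auto simp: lookup_single when_def)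
  then show ?thesis by simp
qed

text \<open>In rows from 3 on, the last edge uses a column one less than the regular pattern;
  consecutive edges are \<open>m - 1 \<ge> 2\<close> columns apart, so the columns still
  differ.\<close>

lemma match_neq:
  assumes "q < q'" "q' \<le> t" "i \<in> {1..m}"
  shows "match q i \<noteq> match q' i"
proof -
  have "Suc q * (m - 1) \<le> q' * (m - 1)" using assms(1) by (intro mult_le_mono1) simp
  then have "q * (m - 1) + (m - 1) \<le> q' * (m - 1)" by simp
  then show ?thesis using assms m by (auto simp: match_def)
qed

lemma coprime_leading_minors:
  assumes n: "(t + 1) * (m - 1) + 1 \<le> n"
  shows "coprime_leading m n (weight wt) {..t} (\<lambda>q. minor m (edge q) :: 'k::field mpoly) lead"
proof
  fix q q' assume "q \<in> {..t}" "q' \<in> {..t}" "q \<noteq> q'"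
  then have "match q i \<noteq> match q' i" if "i \<in> {1..m}" for i
    using match_neq[of q q' i] match_neq[of q' q i] that by (cases "q < q'") auto
  then show "keys (lead q) \<inter> keys (lead q') = {}"
    by (auto simp: in_keys_iff lookup_lead split: if_splits)
next
  fix q x show "lookup (lead q) x \<le> 1"
    by (cases x) (simp add: lookup_lead)
next
  fix q
  have "lookup (lead q) (1, match q 1) = 1" using m by (simp add: lookup_lead)
  then show "lead q \<noteq> 0" by auto
qed (use minor_edge_hleads[OF n] in \<open>auto simp: weight_add\<close>)

section \<open>The functional and the column classes of the cycle\<close>

definition V :: "nat set" where "V = {1..(t + 1) * (m - 1)}"

text \<open>A joint carries two relevant variables, and \<open>d = 1\<close> gives the functional
  that tolerates one of them being absent.\<close>

definition d :: "nat \<Rightarrow> nat" where "d j = (if (j - 1) mod (m - 1) = 0 then 1 else 0)"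

definition second_row :: "nat \<Rightarrow> nat" where "second_row j = (if j = 1 then 2 else m)"

text \<open>
  At a joint, the two binary digits of the class record divisibility by the variables in the two
  rows used by the leading monomials of the adjacent edges.
\<close>

definition cls :: "nat \<Rightarrow> (nat \<Rightarrow> nat) \<Rightarrow> nat" where
  "cls j v = (if d j = 1 then (if v 1 = 0 then 0 else 1) + (if v (second_row j) = 0 then 0 else 2)
     else if v (inner_row j) = 0 then 0 else 1)"

text \<open>Class vectors of monomials that no leading monomial divides: \<open>lead q\<close> needs
  the first digit at joint \<open>q\<close> and the second digit at the cyclically next
  joint.\<close>

definition U :: "(nat \<Rightarrow> nat) set" where
  "U = {\<kappa>. \<forall>q\<le>t. \<not> (odd (\<kappa> (joint q)) \<and> 2 \<le> \<kappa> (joint (Suc q mod Suc t)) \<and>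
     (\<forall>r\<in>{1..<m - 1}. \<kappa> (q * (m - 1) + 1 + r) = 1))}"

lemma V_cases:
  assumes "j \<in> V"
  obtains q where "q \<le> t" "j = joint q" | q r where "q \<le> t" "1 \<le> r" "r < m - 1" "j = q * (m - 1) + 1 + r"
proof -
  define q where "q = (j - 1) div (m - 1)"
  define r where "r = (j - 1) mod (m - 1)"
  have "j - 1 < (t + 1) * (m - 1)" using assms by (simp add: V_def) linarith
  then have q: "q < t + 1" unfolding q_def by (rule less_mult_imp_div_less)
  have r: "r < m - 1" using m by (simp add: r_def)
  have "j - 1 = q * (m - 1) + r" by (simp only: q_def r_def div_mult_mod_eq)
  moreover have "1 \<le> j" using assms by (simp add: V_def)
  ultimately have "j = q * (m - 1) + 1 + r" by linarith
  then show thesis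
    using q r that(1)[of q] that(2)[of q r] by (cases "r = 0") (auto simp: joint_def)
qed

lemma col_in_V:
  assumes "q \<le> t" "r < m - 1" shows "q * (m - 1) + 1 + r \<in> V"
proof -
  have "(t + 1) * (m - 1) = t * (m - 1) + (m - 1)" by simp
  moreover have "q * (m - 1) \<le> t * (m - 1)" using assms by simp
  ultimately have "q * (m - 1) + 1 + r \<le> (t + 1) * (m - 1)" using assms(2) by linarith
  then show ?thesis by (simp add: V_def)
qed

lemma joint_in_V: "q \<le> t \<Longrightarrow> joint q \<in> V"
  using col_in_V[of q 0] m by (simp add: joint_def)

lemma d_joint [simp]: "d (joint q) = 1"
  unfolding d_def joint_div_mod by simp

lemma d_inner: "1 \<le> r \<Longrightarrow> r < m - 1 \<Longrightarrow> d (q * (m - 1) + 1 + r) = 0"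
  unfolding d_def col_div_mod by simp

lemma lead_dvd_iff:
  assumes q: "q \<le> t"
  shows "keys (lead q) \<subseteq> keys u \<longleftrightarrow>
    lookup u (1, joint q) \<noteq> 0 \<and>
    lookup u (second_row (joint (Suc q mod Suc t)), joint (Suc q mod Suc t)) \<noteq> 0 \<and>
    (\<forall>r\<in>{1..<m - 1}. lookup u (inner_row (q * (m - 1) + 1 + r), q * (m - 1) + 1 + r) \<noteq> 0)"
proof -
  have keys: "keys (lead q) \<subseteq> keys u \<longleftrightarrow> (\<forall>i\<in>{1..m}. lookup u (i, match q i) \<noteq> 0)"
    by (auto simp: subset_iff in_keys_iff lookup_lead split: if_splits)
  have second: "second_row (joint (Suc q mod Suc t)) = (if q < t then m else 2)"
    "joint (Suc q mod Suc t) = (if q < t then joint (Suc q) else joint 0)"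
    using q by (auto simp: second_row_def)
  have match_q: "match q 1 = joint q" "match q (if q < t then m else 2) = joint (Suc q mod Suc t)"
    "\<And>r. 1 \<le> r \<Longrightarrow> match q (r + (if q < t then 1 else 2)) = q * (m - 1) + 1 + r"
    unfolding second using m q by (auto simp: match_def joint_def)
  show ?thesis
    unfolding keys second(1)
  proof safe
    assume *: "\<forall>i\<in>{1..m}. lookup u (i, match q i) \<noteq> 0"
    show False if "lookup u (1, joint q) = 0"
      using *[rule_format, of 1] that match_q(1) m by simp
    show False if "lookup u (if q < t then m else 2, joint (Suc q mod Suc t)) = 0"
      using *[rule_format, of "if q < t then m else 2"] that match_q(2) m by (simp split: if_splits)
    fix r assume r: "r \<in> {1..<m - 1}"
      and "lookup u (inner_row (q * (m - 1) + 1 + r), q * (m - 1) + 1 + r) = 0"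
    then have "lookup u (r + (if q < t then 1 else 2), match q (r + (if q < t then 1 else 2))) = 0"
      using match_q(3)[of r] inner_row_col[of r q] by simp
    moreover have "r + (if q < t then 1 else 2) \<in> {1..m}" using r by auto
    ultimately show False using * by blast
  next
    fix i assume 1: "lookup u (1, joint q) \<noteq> 0"
      and 2: "lookup u (if q < t then m else 2, joint (Suc q mod Suc t)) \<noteq> 0"
      and 3: "\<forall>r\<in>{1..<m - 1}. lookup u (inner_row (q * (m - 1) + 1 + r), q * (m - 1) + 1 + r) \<noteq> 0"
      and i: "i \<in> {1..m}" and 0: "lookup u (i, match q i) = 0"
    from i q show False
    proof (cases rule: match_inner)
      case (5 r)
      then have "lookup u (inner_row (q * (m - 1) + 1 + r), q * (m - 1) + 1 + r) \<noteq> 0"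
        using 3 by auto
      then have "lookup u (i, match q i) \<noteq> 0"
        using 5(3) unfolding 5(4) inner_row_col[OF 5(2)] by simp
      then show False using 0 by blast
    qed (use 0 1 2 second(2) in \<open>simp_all del: joint_0\<close>)
  qed
qed

lemma class_weight_inner:
  assumes "q \<le> t" "1 \<le> r" "r < m - 1"
  shows "class_weight m (d (q * (m - 1) + 1 + r)) (\<lambda>v. cls (q * (m - 1) + 1 + r) v = c) = (if c = 1 then 1 else 0)"
proof -
  define j where "j = q * (m - 1) + 1 + r"
  have d: "d j = 0" unfolding j_def by (rule d_inner[OF assms(2,3)])
  have row: "inner_row j \<in> {1..m}" unfolding j_def inner_row_col[OF assms(3)] using assms by auto
  have "class_weight m 0 (\<lambda>v. cls j v = c) = class_weight m 0
      (if c = 0 then \<lambda>v. v (inner_row j) = 0 else if c = 1 then \<lambda>v. v (inner_row j) \<noteq> 0 else (\<lambda>_. False))"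
    by (rule class_weight_cong) (auto simp: cls_def d)
  also have "\<dots> = (if c = 1 then 1 else 0)"
    using class_weight_row_0[OF _ row] m by (auto simp: class_weight_def)
  finally show ?thesis unfolding j_def[symmetric] d .
qed

text \<open>Class 3, both variables dividing, is ruled out in \<open>multiweight_minors\<close> by
  going around the cycle.\<close>

lemma class_weight_joint:
  shows "class_weight m (d (joint q)) (\<lambda>v. cls (joint q) v = 0) = 0"
    "c \<in> {1, 2} \<Longrightarrow> class_weight m (d (joint q)) (\<lambda>v. cls (joint q) v = c) = 1"
proof -
  let ?s = "second_row (joint q)"
  have s: "?s \<in> {1..m}" "1 \<in> {1..m}" "1 \<noteq> ?s" "?s \<noteq> 1" and m2: "m \<ge> 2"
    using m by (auto simp: second_row_def)
  show "class_weight m (d (joint q)) (\<lambda>v. cls (joint q) v = 0) = 0"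
    unfolding d_joint
    by (subst class_weight_cong[where Q="\<lambda>v. v 1 = 0 \<and> v ?s = 0"])
      (use class_weight_row_1[OF m2 s(2,1,3)] in \<open>auto simp: cls_def\<close>)
  assume "c \<in> {1, 2}"
  then consider "c = 1" | "c = 2" by blast
  then show "class_weight m (d (joint q)) (\<lambda>v. cls (joint q) v = c) = 1"
    unfolding d_joint
  proof cases
    case 1
    show "class_weight m 1 (\<lambda>v. cls (joint q) v = c) = 1"
      unfolding 1 by (subst class_weight_cong[where Q="\<lambda>v. v 1 \<noteq> 0 \<and> v ?s = 0"])
        (use class_weight_row_1[OF m2 s(2,1,3)] in \<open>auto simp: cls_def\<close>)
  next
    case 2
    show "class_weight m 1 (\<lambda>v. cls (joint q) v = c) = 1"
      unfolding 2 by (subst class_weight_cong[where Q="\<lambda>v. v ?s \<noteq> 0 \<and> v 1 = 0"])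
        (use class_weight_row_1[OF m2 s(1,2,4)] in \<open>auto simp: cls_def\<close>)
  qed
qed

lemma multiweight_minors:
  assumes n: "(t + 1) * (m - 1) + 1 \<le> n"
    and N: "N = {u \<in> monoms m n. \<exists>q\<in>{..t}. keys (lead q) \<subseteq> keys u}"
  shows "(\<Sum>u\<in>(monoms m n - N) \<inter> box m V. multiweight m V d (mdeg u)) = 2"
proof -
  let ?c = "\<lambda>u. \<lambda>j\<in>V. cls j (\<lambda>i. lookup u (i, j))"
  let ?K = "\<lambda>_ :: nat. {..3 :: nat}"
  let ?F = "\<lambda>\<kappa>. \<Prod>j\<in>V. class_weight m (d j) (\<lambda>v. cls j v = \<kappa> j)"
  have V: "finite V" "V \<subseteq> {1..n}" using n by (auto simp: V_def)
  have mod: "Suc q mod Suc t \<le> t" for q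
    using mod_less_divisor[of "Suc t" "Suc q"] by simp
  have inU: "u \<in> monoms m n - N \<longleftrightarrow> ?c u \<in> U" if u: "u \<in> box m V" for u
  proof -
    have "u \<in> monoms m n" using u V(2) by (auto simp: box_def monoms_def)
    then have "u \<in> monoms m n - N \<longleftrightarrow> (\<forall>q\<le>t. \<not> keys (lead q) \<subseteq> keys u)"
      by (auto simp: N)
    also have "\<dots> \<longleftrightarrow> ?c u \<in> U"
    proof -
      have odd_iff: "odd (?c u (joint q)) \<longleftrightarrow> lookup u (1, joint q) \<noteq> 0"
        and ge_iff: "2 \<le> ?c u (joint q) \<longleftrightarrow> lookup u (second_row (joint q), joint q) \<noteq> 0" if "q \<le> t" for q
        using joint_in_V[OF that] by (simp_all add: cls_def)
      have inner_iff: "?c u (q * (m - 1) + 1 + r) = 1 \<longleftrightarrow>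
          lookup u (inner_row (q * (m - 1) + 1 + r), q * (m - 1) + 1 + r) \<noteq> 0"
        if "q \<le> t" "r \<in> {1..<m - 1}" for q r
      proof -
        have r: "1 \<le> r" "r < m - 1" using that by auto
        show ?thesis
          using col_in_V[OF that(1) r(2)] d_inner[OF r, of q] by (simp only: restrict_apply if_True cls_def) simp
      qed
      have "keys (lead q) \<subseteq> keys u \<longleftrightarrow> odd (?c u (joint q)) \<and> 2 \<le> ?c u (joint (Suc q mod Suc t)) \<and>
          (\<forall>r\<in>{1..<m - 1}. ?c u (q * (m - 1) + 1 + r) = 1)" if "q \<le> t" for q
        unfolding lead_dvd_iff[OF that] odd_iff[OF that] ge_iff[OF mod]
        using inner_iff[OF that] by blast
      then show ?thesis
        unfolding U_def mem_Collect_eq by blast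
    qed
    finally show ?thesis .
  qed
  have "(\<Sum>u\<in>(monoms m n - N) \<inter> box m V. multiweight m V d (mdeg u)) = (\<Sum>\<kappa>\<in>U \<inter> Pi\<^sub>E V ?K. ?F \<kappa>)"
    by (rule multiweight_class_sum[OF V _ _ inU]) (simp_all add: cls_def)
  also have "\<dots> = 2"
  proof -
    \<comment> \<open>The two survivors: with \<open>c = 1\<close> no joint has the second digit,
      with \<open>c = 2\<close> none has the first, so neither meets the condition of any leading
      monomial.\<close>
    define \<kappa> where "\<kappa> c = (\<lambda>j\<in>V. if d j = 1 then c else 1)" for c :: nat
    have \<kappa>_joint: "\<kappa> c (joint q) = c" if "q \<le> t" for c q
      using joint_in_V[OF that] by (simp add: \<kappa>_def)
    have \<kappa>_inner: "\<kappa> c (q * (m - 1) + 1 + r) = 1" if "q \<le> t" "1 \<le> r" "r < m - 1" for c q r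
      using col_in_V[OF that(1,3)] d_inner[OF that(2,3), of q] unfolding \<kappa>_def by (simp only: restrict_apply if_True) simp
    have F1: "?F (\<kappa> c) = 1" if "c \<in> {1, 2}" for c
    proof (rule prod.neutral, rule ballI)
      fix j assume "j \<in> V"
      then show "class_weight m (d j) (\<lambda>v. cls j v = \<kappa> c j) = 1"
      proof (cases rule: V_cases)
        case (1 q)
        show ?thesis unfolding 1(2) \<kappa>_joint[OF 1(1)] by (rule class_weight_joint(2)[OF that])
      next
        case (2 q r)
        show ?thesis unfolding 2(4) \<kappa>_inner[OF 2(1,2,3)] class_weight_inner[OF 2(1,2,3)] by simp
      qed
    qed
    have in_U: "\<kappa> c \<in> U \<inter> Pi\<^sub>E V ?K" if "c \<in> {1, 2}" for c
      using that mod by (auto simp: U_def \<kappa>_joint, auto simp: \<kappa>_def)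
    have zero: "?F \<kappa>' = 0" if \<kappa>': "\<kappa>' \<in> U \<inter> Pi\<^sub>E V ?K" "\<kappa>' \<noteq> \<kappa> 1" "\<kappa>' \<noteq> \<kappa> 2" for \<kappa>'
    proof (rule ccontr)
      assume "?F \<kappa>' \<noteq> 0"
      then have nz: "class_weight m (d j) (\<lambda>v. cls j v = \<kappa>' j) \<noteq> 0" if "j \<in> V" for j
        using that V(1) by auto
      have inner: "\<kappa>' (q * (m - 1) + 1 + r) = 1" if "q \<le> t" "1 \<le> r" "r < m - 1" for q r
        using nz[OF col_in_V[OF that(1,3)]] class_weight_inner[OF that] by (metis (full_types))
      have joint0: "\<kappa>' (joint q) \<noteq> 0" if "q \<le> t" for q
        using nz[OF joint_in_V[OF that]] class_weight_joint(1)[of q] by metis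
      have next1: "\<kappa>' (joint (Suc q mod Suc t)) = 1" if "q \<le> t" "odd (\<kappa>' (joint q))" for q
      proof -
        have "\<not> 2 \<le> \<kappa>' (joint (Suc q mod Suc t))"
          using \<kappa>'(1) that inner[OF that(1)] by (auto simp: U_def)
        then show ?thesis using joint0[OF mod, of q] by linarith
      qed
      have eqI: "\<kappa>' = \<kappa> c" if c: "\<And>q. q \<le> t \<Longrightarrow> \<kappa>' (joint q) = c" for c
      proof
        fix j
        show "\<kappa>' j = \<kappa> c j"
        proof (cases "j \<in> V")
          case True
          then show ?thesis
          proof (cases rule: V_cases)
            case (1 q)
            then show ?thesis using c \<kappa>_joint by metis
          next
            case (2 q r)
            then show ?thesis using inner \<kappa>_inner by metis
          qed
        next
          case False
          then show ?thesis using \<kappa>'(1) by (auto simp: \<kappa>_def PiE_iff extensional_def)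
        qed
      qed
      show False
      proof (cases "\<exists>q\<le>t. odd (\<kappa>' (joint q))")
        case True
        then obtain q0 where q0: "q0 \<le> t" "odd (\<kappa>' (joint q0))" by blast
        \<comment> \<open>After a full turn this covers \<open>q0\<close> itself, so its odd value
          cannot be 3.\<close>
        have iter: "\<kappa>' (joint ((q0 + Suc s) mod Suc t)) = 1" for s
        proof (induction s)
          case 0
          show ?case using next1[OF q0] by simp
        next
          case (Suc s)
          have "(q0 + Suc s) mod Suc t \<le> t" using mod[of "q0 + s"] by simp
          moreover have "odd (\<kappa>' (joint ((q0 + Suc s) mod Suc t)))" unfolding Suc by simp
          ultimately have "\<kappa>' (joint (Suc ((q0 + Suc s) mod Suc t) mod Suc t)) = 1" by (rule next1)
          then show ?case by (simp add: mod_Suc_eq)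
        qed
        have "\<kappa>' (joint q) = 1" if "q \<le> t" for q
        proof -
          \<comment> \<open>The extra \<open>t\<close> keeps the natural subtraction exact when
            \<open>q < q0\<close>; it amounts to one full turn.\<close>
          have "q0 + Suc (q + t - q0) = q + Suc t" using q0(1) by simp
          then have "(q0 + Suc (q + t - q0)) mod Suc t = q" using that by (simp only: mod_add_self2) simp
          then show ?thesis using iter[of "q + t - q0"] by simp
        qed
        then show False using eqI[of 1] \<kappa>'(2) by blast
      next
        case False
        have "\<kappa>' (joint q) = 2" if "q \<le> t" for q
        proof -
          have "\<kappa>' (joint q) \<le> 3" using \<kappa>'(1) joint_in_V[OF that] by auto
          moreover have "even (\<kappa>' (joint q))" using False that by blast
          then obtain k where "\<kappa>' (joint q) = 2 * k" by blast
          ultimately show ?thesis using joint0[OF that] by presburger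
        qed
        then show False using eqI[of 2] \<kappa>'(3) by blast
      qed
    qed
    have neq: "\<kappa> 1 \<noteq> \<kappa> 2" using \<kappa>_joint[of 0] by (metis le0 one_eq_numeral_iff semiring_norm(85))
    have "(\<Sum>\<kappa>'\<in>U \<inter> Pi\<^sub>E V ?K. ?F \<kappa>') = (\<Sum>\<kappa>'\<in>{\<kappa> 1, \<kappa> 2}. ?F \<kappa>')"
    proof (rule sum.mono_neutral_right)
      show "finite (U \<inter> Pi\<^sub>E V ?K)" using V by (intro finite_Int disjI2 finite_PiE) auto
    qed (use in_U zero in auto)
    also have "\<dots> = 2" using neq F1 by simp
    finally show ?thesis .
  qed
  finally show ?thesis .
qed

lemma edges_eq:
  assumes "E = {block (l * (m - 1) + 2 - m) m | l. l \<in> {1..t}} \<union>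
           {(block ((t + 1) * (m - 1) + 2 - m) m - {(t + 1) * (m - 1) + 1}) \<union> {1}}"
  shows "E = edge ` {..t}"
proof -
  have start: "Suc q * (m - 1) + 2 - m = q * (m - 1) + 1" for q
    using m by simp
  have "{block (l * (m - 1) + 2 - m) m | l. l \<in> {1..t}} = edge ` {..<t}"
  proof -
    have "{1..t} = Suc ` {..<t}" by (simp add: image_Suc_lessThan)
    then have "{block (l * (m - 1) + 2 - m) m | l. l \<in> {1..t}} = (\<lambda>q. block (Suc q * (m - 1) + 2 - m) m) ` {..<t}"
      by (auto simp del: mult_Suc)
    also have "\<dots> = edge ` {..<t}"
      unfolding start using m by (intro image_cong refl) (auto simp: block_def edge_def)
    finally show ?thesis .
  qed
  moreover have "(block ((t + 1) * (m - 1) + 2 - m) m - {(t + 1) * (m - 1) + 1}) \<union> {1} = edge t"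
    using start[of t] m by (auto simp: block_def edge_def)
  ultimately have "E = edge ` {..<t} \<union> {edge t}" using assms by simp
  then show ?thesis by (simp add: lessThan_Suc flip: lessThan_Suc_atMost)
qed

end

theorem proposition5p6:
  fixes m t n :: nat and E :: "nat set set"
  assumes "infinite (UNIV :: 'k::field set)"
    and "m \<ge> 3" and "t \<ge> 1" and "(t + 1) * (m - 1) + 1 \<le> n"
    and "E = {block (l * (m - 1) + 2 - m) m | l. l \<in> {1..t}} \<union>
           {(block ((t + 1) * (m - 1) + 2 - m) m - {(t + 1) * (m - 1) + 1}) \<union> {1}}"
  shows "\<not> cartwright_sturmfels m n (hypergraph_ideal m n E :: 'k mpoly set)"
proof
  interpret hypercycle m t using assms by unfold_locales
  interpret coprime_leading m n "weight wt" "{..t}" "\<lambda>q. minor m (edge q) :: 'k mpoly" lead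
    by (rule coprime_leading_minors[OF assms(4)])
  let ?I = "hypergraph_ideal m n E :: 'k mpoly set"
  assume "cartwright_sturmfels m n ?I"
  then obtain J :: "'k mpoly set" where J: "monomial_ideal m n J" "radical_ideal m n J" "borel_fixed m n J"
    "hilbert_series m n J = hilbert_series m n ?I"
    by (auto simp: cartwright_sturmfels_def)
  from J(1) obtain N where N: "N \<subseteq> monoms m n" "J = {p. keys p \<subseteq> N}"
    "\<And>u v. u \<in> N \<Longrightarrow> v \<in> monoms m n \<Longrightarrow> u + v \<in> N"
    by (rule monomial_idealE) (rule that, auto)
  have sub: "initial_monoms \<subseteq> monoms m n" by (auto simp: initial_monoms_def)
  have I: "?I = genideal (poly_ring m n) ((\<lambda>q. minor m (edge q)) ` {..t})"
    using edges_eq[OF assms(5)] by (simp add: hypergraph_ideal_def image_image)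
  have card: "card {u \<in> N. mdeg u = a} = card {u \<in> initial_monoms. mdeg u = a}" for a
  proof -
    have "J \<inter> graded_part m n a = {p. keys p \<subseteq> {u \<in> N. mdeg u = a}}"
      using N(1) by (auto simp: N(2) graded_part_eq)
    then have "mpv.dim (J \<inter> graded_part m n a) = card {u \<in> N. mdeg u = a}"
      by (simp only: dim_monomial_span)
    moreover have "mpv.dim (?I \<inter> graded_part m n a) = card {u \<in> initial_monoms. mdeg u = a}"
      unfolding I by (rule dim_genideal)
    ultimately show ?thesis
      using fun_cong[OF J(4), of a] by (simp add: hilbert_series_def)
  qed
  \<comment> \<open>The class description concerns the monomials outside the ideals, while the
    Hilbert series count those inside. Each multidegree has finitely many monomials, so the counts
    can be subtracted.\<close>
  have compl: "card {u \<in> monoms m n - M. mdeg u = a} = card {u \<in> monoms m n. mdeg u = a} - card {u \<in> M. mdeg u = a}"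
    if "M \<subseteq> monoms m n" for M a
  proof -
    have "{u \<in> monoms m n - M. mdeg u = a} = {u \<in> monoms m n. mdeg u = a} - {u \<in> M. mdeg u = a}" by blast
    moreover have "{u \<in> M. mdeg u = a} \<subseteq> {u \<in> monoms m n. mdeg u = a}" using that by blast
    ultimately show ?thesis
      using finite_monoms_mdeg[of m n a] by (simp add: card_Diff_subset finite_subset)
  qed
  have V: "finite V" "V \<subseteq> {1..n}" using assms(4) by (auto simp: V_def)
  have "card {u \<in> monoms m n - N. mdeg u = a} = card {u \<in> monoms m n - initial_monoms. mdeg u = a}" for a
    by (simp only: compl[OF N(1)] compl[OF sub] card)
  then have "(\<Sum>u\<in>(monoms m n - N) \<inter> box m V. multiweight m V d (mdeg u))
    = (\<Sum>u\<in>(monoms m n - initial_monoms) \<inter> box m V. multiweight m V d (mdeg u))"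
    by (intro multiweight_cong[OF _ _ V]) auto
  also have "\<dots> = 2"
    by (rule multiweight_minors[OF assms(4)]) (simp add: initial_monoms_def)
  finally have two: "(\<Sum>u\<in>(monoms m n - N) \<inter> box m V. multiweight m V d (mdeg u)) = 2" .
  have "d j \<le> 1" for j by (simp add: d_def)
  then have "(\<Sum>u\<in>(monoms m n - N) \<inter> box m V. multiweight m V d (mdeg u)) \<in> {0, 1}"
    by (intro multiweight_borel[OF _ V _ J(2,3) N(2,1,3)]) (use assms(2) in auto)
  then show False unfolding two by simp
qed

end
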